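(* For every small enough $\epsilon>0$ there exists $c>0$ such that for all sufficiently large $n$, when playing a $b$-biased Avoider--Enforcer game on $E(K_n)$ with $b\le (1-\epsilon)\frac{n}{2}$, Enforcer has a strategy to force a minor of the complete graph $K_{c\sqrt{n}}$ in Avoider's graph (the graph of all edges claimed by Avoider by the end of the game).
   Context: In the (strict rules) Avoider--Enforcer game with integer bias $b\ge 1$ on the edge set $E(K_n)$ of the complete graph on $n$ vertices, two players, Avoider and Enforcer, alternately claim free (previously unclaimed) edges of $K_n$, with Enforcer moving first. Avoider claims one edge at a time, while Enforcer claims exactly $b$ edges per move (or all remaining edges if fewer than $b$ remain). The game ends when all edges are claimed. Having a strategy means achieving the goal against every play of the opponent. A graph $G$ contains a graph $H$ with vertex set $\{u_1,\ldots,u_t\}$ as a minor if there are pairwise disjoint vertex subsets $V_1,\ldots,V_t$ of $G$, each spanning a (nonempty) connected subgraph of $G$, such that whenever $(u_i,u_j)$ is an edge of $H$, $G$ has an edge between $V_i$ and $V_j$. Rounding is suppressed: $K_{c\sqrt n}$ means the complete graph on $\lfloor c\sqrt n\rfloor$ vertices. *)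

theory Defs
  imports Complex_Main "HOL-Library.Disjoint_Sets"
begin

text \<open>Simple graphs: a vertex set together with a set of two-element edges.\<close>

type_synonym 'a graph = "'a set \<times> 'a set set"

definition complete_edges :: "'a set \<Rightarrow> 'a set set" where
  "complete_edges V = {e. e \<subseteq> V \<and> card e = 2}"

definition complete_graph :: "'a set \<Rightarrow> 'a graph" where
  "complete_graph V = (V, complete_edges V)"

definition spans_connected :: "'a set set \<Rightarrow> 'a set \<Rightarrow> bool" where
  "spans_connected E W \<longleftrightarrow> W \<noteq> {} \<and>
     (\<forall>x\<in>W. \<forall>y\<in>W. (x, y) \<in> {(u, v). u \<in> W \<and> v \<in> W \<and> {u, v} \<in> E}\<^sup>*)"

text \<open>In \<open>has_minor G H\<close>, \<open>B u\<close> is the vertex subset of \<open>G\<close> that represents the vertex \<open>u\<close> of \<open>H\<close>.\<close>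

definition has_minor :: "'a graph \<Rightarrow> 'b graph \<Rightarrow> bool" where
  "has_minor G H \<longleftrightarrow> (\<exists>B :: 'b \<Rightarrow> 'a set.
     disjoint_family_on B (fst H) \<and>
     (\<forall>u \<in> fst H. B u \<subseteq> fst G \<and> spans_connected (snd G) (B u)) \<and>
     (\<forall>u \<in> fst H. \<forall>v \<in> fst H. {u, v} \<in> snd H \<longrightarrow>
        (\<exists>x \<in> B u. \<exists>y \<in> B v. {x, y} \<in> snd G)))"

text \<open>
  The strict \<open>b\<close>-biased game on a finite board \<open>X\<close>. A play is the list of all moves made
  so far, oldest first, each move being the set of board elements claimed by it. Enforcer moves first, so
  the moves at even positions are Enforcer's and those at odd positions are Avoider's.
\<close>

definition free_elems :: "'e set \<Rightarrow> 'e set list \<Rightarrow> 'e set" where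
  "free_elems X ms = X - \<Union>(set ms)"

definition legal_move :: "'e set \<Rightarrow> nat \<Rightarrow> 'e set list \<Rightarrow> 'e set \<Rightarrow> bool" where
  "legal_move X k ms M \<longleftrightarrow>
     M \<subseteq> free_elems X ms \<and> card M = min k (card (free_elems X ms))"

definition legal_play :: "'e set \<Rightarrow> nat \<Rightarrow> 'e set list \<Rightarrow> bool" where
  "legal_play X b ms \<longleftrightarrow> (\<forall>i < length ms. free_elems X (take i ms) \<noteq> {} \<and>
     legal_move X (if even i then b else 1) (take i ms) (ms ! i))"

definition avoider_claims :: "'e set list \<Rightarrow> 'e set" where
  "avoider_claims ms = (\<Union>i \<in> {i. i < length ms \<and> odd i}. ms ! i)"

definition enforcer_strategy :: "'e set \<Rightarrow> nat \<Rightarrow> ('e set list \<Rightarrow> 'e set) \<Rightarrow> bool" where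
  "enforcer_strategy X b \<sigma> \<longleftrightarrow>
     (\<forall>ms. legal_play X b ms \<and> even (length ms) \<and> free_elems X ms \<noteq> {} \<longrightarrow>
        legal_move X b ms (\<sigma> ms))"

definition enforcer_follows :: "('e set list \<Rightarrow> 'e set) \<Rightarrow> 'e set list \<Rightarrow> bool" where
  "enforcer_follows \<sigma> ms \<longleftrightarrow> (\<forall>i < length ms. even i \<longrightarrow> ms ! i = \<sigma> (take i ms))"

definition enforcer_can_force :: "'e set \<Rightarrow> nat \<Rightarrow> ('e set \<Rightarrow> bool) \<Rightarrow> bool" where
  "enforcer_can_force X b P \<longleftrightarrow>
     (\<exists>\<sigma>. enforcer_strategy X b \<sigma> \<and>
        (\<forall>ms. legal_play X b ms \<and> enforcer_follows \<sigma> ms \<and> free_elems X ms = {} \<longrightarrow>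
           P (avoider_claims ms)))"

end

theory Submission
  imports Defs "HOL-Analysis.Convex"
begin

text \<open>
  By a single potential argument of Beck's type Enforcer, playing as Breaker, prevents Avoider from making
  any set of at most \<open>\<alpha> * n\<close> vertices \<open>W\<close> span \<open>k * card W\<close> edges, for some \<open>k\<close> below the ratio
  \<open>c \<ge> 1 + \<epsilon> / 2\<close> of edges to vertices that Avoider is bound to reach, and from having many edges at
  vertices of degree much larger than \<open>c\<close>. Deleting the latter edges leaves a locally sparse graph of maximum
  degree \<open>O(c)\<close>, whose smallest subset \<open>U\<close> with at least \<open>k * card U + \<delta> * (card U)\<^sup>2 / n\<close> edges is an
  expander with linearly many vertices.

  Such an expander contains a complete minor with about the square root of its order many branch sets of
  about that same size. These are found one at a time: a random walk of length
  \<open>r\<close>, with \<open>r\<^sup>2\<close> about \<open>card U\<close>, is expected to end up at bounded total distance from the neighbourhood of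
  each earlier branch set, hence can be joined to all of them by \<open>O(r)\<close> further vertices.
  All bounds depend only on the ratio of expansion to degree, so small biases need no separate treatment.
\<close>

section \<open>A potential strategy for Enforcer\<close>

text \<open>The threshold \<open>n / 2\<close> is where Avoider must end up with more than one edge
  per vertex, and the potential needs this. There are about \<open>(n / w) ^ w\<close> sets of
  \<open>w\<close> vertices, and \<open>k * w\<close> edges inside one of them contribute about
  \<open>(w / n) ^ (k * w)\<close>; for small \<open>w / n\<close> the sum over all sets is small
  only if \<open>k > 1\<close>. The gap between \<open>k\<close> and \<open>c\<close> then pays for
  the deleted edges and for the quadratic term that yields the expansion. The obstacle in the
  expander is a logarithm. A branch set must meet up to about \<open>sqrt n\<close> neighbourhoods
  of about \<open>sqrt n\<close> vertices each. Separate paths could each be as long as the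
  diameter, of order \<open>log n\<close>, and branch sets that large leave room for too few. One
  walk of length about \<open>sqrt n\<close> serves all neighbourhoods at once: it comes so close to
  them that the detours have bounded average length.\<close>

definition enforcer_claims :: "'e set list \<Rightarrow> 'e set" where
  "enforcer_claims ms = (\<Union>i \<in> {i. i < length ms \<and> even i}. ms ! i)"

lemma avoider_claims_Nil [simp]: "avoider_claims [] = {}"
  by (simp add: avoider_claims_def)

lemma enforcer_claims_Nil [simp]: "enforcer_claims [] = {}"
  by (simp add: enforcer_claims_def)

lemma avoider_claims_snoc:
  "avoider_claims (ms @ [M]) = (if odd (length ms) then avoider_claims ms \<union> M else avoider_claims ms)"
  by (auto simp: avoider_claims_def nth_append less_Suc_eq split: if_splits)

lemma enforcer_claims_snoc:
  "enforcer_claims (ms @ [M]) = (if even (length ms) then enforcer_claims ms \<union> M else enforcer_claims ms)"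
  by (auto simp: enforcer_claims_def nth_append less_Suc_eq split: if_splits)

lemma claims_Un: "avoider_claims ms \<union> enforcer_claims ms = \<Union>(set ms)"
  by (induction ms rule: rev_induct) (auto simp: avoider_claims_snoc enforcer_claims_snoc)

lemma legal_play_snoc:
  "legal_play X b (ms @ [M]) \<longleftrightarrow> legal_play X b ms \<and> free_elems X ms \<noteq> {} \<and>
     legal_move X (if even (length ms) then b else 1) ms M"
  by (simp add: legal_play_def nth_append All_less_Suc conj_commute)

lemma enforcer_follows_snoc:
  "enforcer_follows \<sigma> (ms @ [M]) \<longleftrightarrow> enforcer_follows \<sigma> ms \<and> (even (length ms) \<longrightarrow> M = \<sigma> ms)"
  by (simp add: enforcer_follows_def nth_append All_less_Suc conj_commute)

lemma single_move:
  assumes "legal_move X (if even (length ms) then b else 1) ms M" "odd (length ms)"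
    "free_elems X ms \<noteq> {}" "finite (free_elems X ms)"
  shows "card M = 1"
proof -
  have "0 < card (free_elems X ms)" using assms(3,4) by (simp add: card_gt_0_iff)
  then show ?thesis using assms(1,2) by (simp add: legal_move_def min_def)
qed

text \<open>Enforcer moves first, so after an odd number of moves it is one move ahead. Avoider's
  moves have exactly one element, as a play continues only while something is free, but Enforcer's
  last move may be short; hence only an inequality.\<close>

lemma legal_play_claims:
  assumes "finite X" "legal_play X b ms"
  shows "avoider_claims ms \<subseteq> X \<and> enforcer_claims ms \<subseteq> X \<and> avoider_claims ms \<inter> enforcer_claims ms = {}
     \<and> card (enforcer_claims ms) \<le> b * (card (avoider_claims ms) + (if even (length ms) then 0 else 1))"
  using assms(2)
proof (induction ms rule: rev_induct)
  case (snoc M ms)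
  have l: "legal_play X b ms" and ne: "free_elems X ms \<noteq> {}"
    and m: "legal_move X (if even (length ms) then b else 1) ms M"
    using snoc.prems by (auto simp: legal_play_snoc)
  note IH = snoc.IH[OF l]
  have fr: "free_elems X ms = X - (avoider_claims ms \<union> enforcer_claims ms)"
    by (simp add: free_elems_def claims_Un)
  have fin: "finite (avoider_claims ms)" "finite (enforcer_claims ms)" "finite M" "finite (free_elems X ms)"
    using IH assms(1) m by (auto simp: legal_move_def fr intro: finite_subset)
  show ?case
  proof (cases "even (length ms)")
    case True
    have "card (enforcer_claims ms \<union> M) \<le> card (enforcer_claims ms) + b"
      using card_Un_le[of "enforcer_claims ms" M] m True by (auto simp: legal_move_def)
    then show ?thesis using True IH m
      unfolding avoider_claims_snoc enforcer_claims_snoc legal_move_def fr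
      by (simp add: algebra_simps) blast
  next
    case False
    have "card M = 1"
      using single_move m False ne fin(4) by metis
    moreover have "avoider_claims ms \<inter> M = {}" using m by (auto simp: legal_move_def fr)
    ultimately have "card (avoider_claims ms \<union> M) = card (avoider_claims ms) + 1"
      using fin by (simp add: card_Un_disjoint)
    then show ?thesis using False IH m
      unfolding avoider_claims_snoc enforcer_claims_snoc legal_move_def fr
      by (simp add: algebra_simps) blast
  qed
qed simp

lemma card_avoider_claims_ge:
  assumes "finite X" "legal_play X b ms" "free_elems X ms = {}"
  shows "card X \<le> (b + 1) * card (avoider_claims ms) + b"
proof -
  note c = legal_play_claims[OF assms(1,2)]
  have "X = avoider_claims ms \<union> enforcer_claims ms"
    using c assms(3) unfolding free_elems_def claims_Un[symmetric] by blast
  then have "card X \<le> card (avoider_claims ms) + card (enforcer_claims ms)"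
    by (metis card_Un_le)
  also have "\<dots> \<le> card (avoider_claims ms) + b * (card (avoider_claims ms) + 1)"
    using c by (auto split: if_splits)
  finally show ?thesis by (simp add: algebra_simps)
qed

text \<open>The family is indexed so that one edge set may occur several times, as a dense spot of
  several vertex sets or as a star, with its own cost \<open>c i\<close> each time.\<close>

locale weighted_family =
  fixes I :: "'i set" and F :: "'i \<Rightarrow> 'e set" and c :: "'i \<Rightarrow> real" and b :: nat
  assumes fin_I: "finite I" and fin_F: "\<And>i. i \<in> I \<Longrightarrow> finite (F i)"
    and c_nonneg: "\<And>i. i \<in> I \<Longrightarrow> 0 \<le> c i"
begin

text \<open>Each element that Avoider still lacks in \<open>F i\<close> costs a factor
  \<open>1 + b\<close>. The quotient of powers avoids a truncated subtraction in the
  exponent.\<close>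

definition weight :: "'e set \<Rightarrow> 'i \<Rightarrow> real" where
  "weight A i = c i * (1 + real b) ^ card (F i \<inter> A) / (1 + real b) ^ card (F i)"

definition potential :: "'e set \<Rightarrow> 'e set \<Rightarrow> real" where
  "potential A M = (\<Sum>i \<in> {i \<in> I. F i \<inter> M = {}}. weight A i)"

text \<open>The potential that Enforcer removes by claiming \<open>x\<close>. If Avoider claims
  \<open>x\<close> instead, the potential rises by \<open>b\<close> times this amount.\<close>

definition danger :: "'e set \<Rightarrow> 'e set \<Rightarrow> 'e \<Rightarrow> real" where
  "danger A M x = (\<Sum>i \<in> {i \<in> I. F i \<inter> M = {} \<and> x \<in> F i}. weight A i)"

lemma weight_nonneg: "i \<in> I \<Longrightarrow> 0 \<le> weight A i"
  by (simp add: weight_def c_nonneg)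

lemma potential_insert: "potential A (insert y M) = potential A M - danger A M y"
proof -
  have "{i \<in> I. F i \<inter> M = {}} = {i \<in> I. F i \<inter> insert y M = {}} \<union> {i \<in> I. F i \<inter> M = {} \<and> y \<in> F i}"
    by auto
  then have "potential A M = potential A (insert y M) + danger A M y"
    unfolding potential_def danger_def
    by (subst sum.union_disjoint [symmetric]) (use fin_I in auto)
  then show ?thesis by simp
qed

lemma potential_mono: "M \<subseteq> M' \<Longrightarrow> potential A M' \<le> potential A M"
  unfolding potential_def using fin_I weight_nonneg by (intro sum_mono2) auto

lemma danger_mono: "M \<subseteq> M' \<Longrightarrow> danger A M' x \<le> danger A M x"
  unfolding danger_def using fin_I weight_nonneg by (intro sum_mono2) auto

lemma potential_insert_avoider:
  assumes "x \<notin> A"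
  shows "potential (insert x A) M = potential A M + real b * danger A M x"
proof -
  have w: "weight (insert x A) i = weight A i + (if x \<in> F i then real b * weight A i else 0)"
    if "i \<in> I" for i
  proof (cases "x \<in> F i")
    case True
    then have "F i \<inter> insert x A = insert x (F i \<inter> A)" by auto
    then have "card (F i \<inter> insert x A) = Suc (card (F i \<inter> A))"
      using assms fin_F[OF that] by simp
    then show ?thesis using True by (simp add: weight_def field_simps)
  qed (simp add: weight_def)
  have "potential (insert x A) M
      = (\<Sum>i \<in> {i \<in> I. F i \<inter> M = {}}. weight A i + (if x \<in> F i then real b * weight A i else 0))"
    unfolding potential_def by (rule sum.cong) (auto simp: w)
  also have "\<dots> = potential A M + (\<Sum>i \<in> {i \<in> I. F i \<inter> M = {}}. if x \<in> F i then real b * weight A i else 0)"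
    by (simp add: sum.distrib potential_def)
  also have "(\<Sum>i \<in> {i \<in> I. F i \<inter> M = {}}. if x \<in> F i then real b * weight A i else 0)
      = real b * danger A M x"
    unfolding danger_def sum_distrib_left
    by (rule sum.mono_neutral_cong_right) (use fin_I in auto)
  finally show ?thesis .
qed

text \<open>Each of the \<open>k\<close> picks maximises the current danger. Dangers only fall as
  \<open>M\<close> grows, so every pick lowers the potential by at least the final danger of any
  element that is left.\<close>

lemma greedy_move:
  assumes "finite X" "k \<le> card X"
  shows "\<exists>S \<subseteq> X. card S = k \<and>
    (\<forall>x \<in> X - S. real k * danger A (M \<union> S) x \<le> potential A M - potential A (M \<union> S))"
  using assms(2)
proof (induction k)
  case 0
  show ?case by (intro exI[of _ "{}"]) simp
next
  case (Suc k)
  then obtain S where S: "S \<subseteq> X" "card S = k"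
    and d: "\<And>x. x \<in> X - S \<Longrightarrow> real k * danger A (M \<union> S) x \<le> potential A M - potential A (M \<union> S)"
    by (metis Suc_leD)
  have fin: "finite S" using S assms(1) finite_subset by blast
  have ne: "X - S \<noteq> {}"
  proof
    assume "X - S = {}"
    then have "card X \<le> card S" using fin by (intro card_mono) auto
    then show False using S Suc.prems by simp
  qed
  have img: "Max (danger A (M \<union> S) ` (X - S)) \<in> danger A (M \<union> S) ` (X - S)"
    using assms(1) ne by (intro Max_in) auto
  then obtain y where "y \<in> X - S" "Max (danger A (M \<union> S) ` (X - S)) = danger A (M \<union> S) y"
    by blast
  then have y: "y \<in> X - S" "\<And>x. x \<in> X - S \<Longrightarrow> danger A (M \<union> S) x \<le> danger A (M \<union> S) y"
    using assms(1) by (metis Max_ge finite_Diff finite_imageI imageI)+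
  have "real (Suc k) * danger A (M \<union> insert y S) x \<le> potential A M - potential A (M \<union> insert y S)"
    if "x \<in> X - insert y S" for x
  proof -
    have "danger A (M \<union> insert y S) x \<le> danger A (M \<union> S) x" by (rule danger_mono) auto
    then have "real (Suc k) * danger A (M \<union> insert y S) x \<le> real (Suc k) * danger A (M \<union> S) x"
      by (intro mult_left_mono) auto
    also have "\<dots> \<le> potential A M - potential A (M \<union> S) + danger A (M \<union> S) y"
      using d[of x] y(2)[of x] that by (simp add: algebra_simps)
    also have "\<dots> = potential A M - potential A (M \<union> insert y S)"
      using potential_insert[of A y "M \<union> S"] by simp
    finally show ?thesis .
  qed
  then show ?case using S y(1) fin
    by (intro exI[of _ "insert y S"]) auto
qed

text \<open>Beck's criterion for Breaker: if every one of Enforcer's \<open>b\<close> picks has maximal danger, the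
  potential lost in a move outweighs \<open>b\<close> times the danger of whatever Avoider picks next.\<close>

lemma enforcer_can_force_weight:
  assumes "finite X"
  shows "enforcer_can_force X b
    (\<lambda>A. (\<Sum>i \<in> {i \<in> I. F i \<subseteq> A}. c i) \<le> (\<Sum>i\<in>I. c i / (1 + real b) ^ card (F i)))"
proof -
  define good where "good ms S \<longleftrightarrow> legal_move X b ms S \<and> 
    (\<forall>x \<in> free_elems X ms - S. real b * danger (avoider_claims ms) (enforcer_claims ms \<union> S) x
       \<le> potential (avoider_claims ms) (enforcer_claims ms)
          - potential (avoider_claims ms) (enforcer_claims ms \<union> S))" for ms S
  define \<sigma> where "\<sigma> ms = (SOME S. good ms S)" for ms
  have fin_free: "finite (free_elems X ms)" for ms using assms by (simp add: free_elems_def)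
  have "\<exists>S. good ms S" for ms
  proof (cases "b \<le> card (free_elems X ms)")
    case True
    then show ?thesis using greedy_move[OF fin_free True] by (auto simp: good_def legal_move_def min_def)
  next
    case False
    \<comment> \<open>With fewer than \<open>b\<close> elements left Enforcer takes them all, and no
      element remains for which the bound would have to hold.\<close>
    then have "good ms (free_elems X ms)" by (simp add: good_def legal_move_def)
    then show ?thesis by blast
  qed
  then have \<sigma>: "good ms (\<sigma> ms)" for ms unfolding \<sigma>_def by (rule someI_ex)
  define P0 where "P0 = (\<Sum>i\<in>I. c i / (1 + real b) ^ card (F i))"
  \<comment> \<open>After a move of Enforcer the invariant covers every possible answer of Avoider,
    since the move has to pay for that answer in advance.\<close>
  have inv: "potential (avoider_claims ms) (enforcer_claims ms) \<le> P0 \<and>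
      (odd (length ms) \<longrightarrow> (\<forall>x \<in> free_elems X ms.
          potential (insert x (avoider_claims ms)) (enforcer_claims ms) \<le> P0))"
    if "legal_play X b ms" "enforcer_follows \<sigma> ms" for ms
    using that
  proof (induction ms rule: rev_induct)
    case Nil
    then show ?case by (simp add: P0_def potential_def weight_def)
  next
    case (snoc M ms)
    have l: "legal_play X b ms" and fo: "enforcer_follows \<sigma> ms" and ne: "free_elems X ms \<noteq> {}"
      and m: "legal_move X (if even (length ms) then b else 1) ms M"
      using snoc.prems by (auto simp: legal_play_snoc enforcer_follows_snoc)
    note IH = snoc.IH[OF l fo]
    show ?case
    proof (cases "even (length ms)")
      case True
      then have M: "M = \<sigma> ms" using snoc.prems by (simp add: enforcer_follows_snoc)
      have "potential (insert x (avoider_claims ms)) (enforcer_claims ms \<union> M) \<le> P0"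
        if "x \<in> free_elems X (ms @ [M])" for x
      proof -
        have x: "x \<in> free_elems X ms - M" using that by (auto simp: free_elems_def)
        then have "x \<notin> avoider_claims ms" using claims_Un[of ms] by (auto simp: free_elems_def)
        moreover have "real b * danger (avoider_claims ms) (enforcer_claims ms \<union> M) x
            \<le> potential (avoider_claims ms) (enforcer_claims ms)
               - potential (avoider_claims ms) (enforcer_claims ms \<union> M)"
          using \<sigma>[of ms] x unfolding good_def M by blast
        ultimately show ?thesis using IH by (simp add: potential_insert_avoider)
      qed
      moreover have "potential (avoider_claims ms) (enforcer_claims ms \<union> M) \<le> P0"
        using IH potential_mono[of "enforcer_claims ms" "enforcer_claims ms \<union> M"]
        by (meson Un_upper1 order_trans)
      ultimately show ?thesis using True by (simp add: avoider_claims_snoc enforcer_claims_snoc)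
    next
      case False
      have "card M = 1"
        using single_move m False ne fin_free[of ms] by metis
      then obtain x where x: "M = {x}" by (auto simp: card_1_singleton_iff)
      then have "x \<in> free_elems X ms" using m by (auto simp: legal_move_def)
      then show ?thesis using IH False x by (simp add: avoider_claims_snoc enforcer_claims_snoc)
    qed
  qed
  have "(\<Sum>i \<in> {i \<in> I. F i \<subseteq> avoider_claims ms}. c i) \<le> P0"
    if "legal_play X b ms" "enforcer_follows \<sigma> ms" for ms
  proof -
    have dis: "avoider_claims ms \<inter> enforcer_claims ms = {}"
      using legal_play_claims[OF assms that(1)] by blast
    have "(\<Sum>i \<in> {i \<in> I. F i \<subseteq> avoider_claims ms}. c i)
        = (\<Sum>i \<in> {i \<in> I. F i \<subseteq> avoider_claims ms}. weight (avoider_claims ms) i)"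
      by (rule sum.cong) (auto simp: weight_def Int_absorb2)
    also have "\<dots> \<le> potential (avoider_claims ms) (enforcer_claims ms)"
      unfolding potential_def using dis fin_I weight_nonneg by (intro sum_mono2) auto
    also have "\<dots> \<le> P0" using inv[OF that] by blast
    finally show ?thesis .
  qed
  moreover have "enforcer_strategy X b \<sigma>"
    using \<sigma> by (simp add: enforcer_strategy_def good_def)
  ultimately show ?thesis unfolding enforcer_can_force_def P0_def by blast
qed

end

lemma enforcer_can_force_mono:
  assumes "enforcer_can_force X b P"
    and "\<And>ms. legal_play X b ms \<Longrightarrow> free_elems X ms = {} \<Longrightarrow> P (avoider_claims ms) \<Longrightarrow> Q (avoider_claims ms)"
  shows "enforcer_can_force X b Q"
  using assms unfolding enforcer_can_force_def by blast

section \<open>Random walks in expanders\<close>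

definition adj :: "'a set set \<Rightarrow> 'a \<Rightarrow> 'a \<Rightarrow> real" where
  "adj E x y = of_bool ({x, y} \<in> E)"

text \<open>A sum over ordered pairs: for disjoint \<open>X\<close> and \<open>Y\<close> it is the
  number of edges between them.\<close>

definition cut_size :: "'a set set \<Rightarrow> 'a set \<Rightarrow> 'a set \<Rightarrow> real" where
  "cut_size E X Y = (\<Sum>x\<in>X. \<Sum>y\<in>Y. adj E x y)"

lemma adj_commute: "adj E x y = adj E y x"
  by (simp add: adj_def insert_commute)

lemma adj_nonneg [simp]: "0 \<le> adj E x y"
  by (simp add: adj_def)

lemma adj_square [simp]: "(adj E x y)\<^sup>2 = adj E x y"
  by (simp add: adj_def)

lemma adj_mult_idem [simp]: "adj E x y * (adj E x y * z) = adj E x y * z"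
  by (simp add: adj_def)

lemma cut_size_commute: "cut_size E X Y = cut_size E Y X"
  unfolding cut_size_def by (subst sum.swap) (simp add: adj_commute)

lemma cut_size_Un_left:
  "finite X \<Longrightarrow> finite X' \<Longrightarrow> X \<inter> X' = {} \<Longrightarrow> cut_size E (X \<union> X') Y = cut_size E X Y + cut_size E X' Y"
  by (simp add: cut_size_def sum.union_disjoint)

lemma cut_size_Un_right:
  "finite Y \<Longrightarrow> finite Y' \<Longrightarrow> Y \<inter> Y' = {} \<Longrightarrow> cut_size E X (Y \<union> Y') = cut_size E X Y + cut_size E X Y'"
  by (metis cut_size_Un_left cut_size_commute)

lemma cut_size_nonneg: "0 \<le> cut_size E X Y"
  by (simp add: cut_size_def sum_nonneg)

lemma cut_size_mono:
  "finite X' \<Longrightarrow> finite Y' \<Longrightarrow> X \<subseteq> X' \<Longrightarrow> Y \<subseteq> Y' \<Longrightarrow> cut_size E X Y \<le> cut_size E X' Y'"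
  unfolding cut_size_def
  by (rule order_trans[OF sum_mono[OF sum_mono2] sum_mono2]) (auto intro: sum_nonneg)

lemma cut_size_le_degree:
  assumes "\<And>x. x \<in> X \<Longrightarrow> (\<Sum>y\<in>Y. adj E x y) \<le> D"
  shows "cut_size E X Y \<le> D * card X"
  unfolding cut_size_def using sum_bounded_above[of X "\<lambda>x. \<Sum>y\<in>Y. adj E x y" D] assms
  by (simp add: mult.commute)

lemma cut_size_pos_imp_edge:
  assumes "0 < cut_size E X Y"
  shows "\<exists>x\<in>X. \<exists>y\<in>Y. {x, y} \<in> E"
proof (rule ccontr)
  assume "\<not> ?thesis"
  then have "cut_size E X Y = 0" unfolding cut_size_def
    by (intro sum.neutral ballI) (auto simp: adj_def)
  then show False using assms by simp
qed

text \<open>Only vertices of \<open>Y\<close> with a neighbour in \<open>X\<close> contribute, at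
  most \<open>D\<close> each. This turns edge expansion into vertex expansion.\<close>

lemma cut_size_le_card_neighbours:
  assumes "finite X" "finite Y"
    and "\<And>y. y \<in> Y \<Longrightarrow> (\<Sum>x\<in>X. adj E y x) \<le> D"
  shows "cut_size E X Y \<le> D * card {y \<in> Y. \<exists>x\<in>X. {x, y} \<in> E}"
proof -
  let ?N = "{y \<in> Y. \<exists>x\<in>X. {x, y} \<in> E}"
  have "cut_size E X Y = cut_size E ?N X"
    unfolding cut_size_commute[of E X Y] unfolding cut_size_def
  proof (rule sum.mono_neutral_right)
    show "\<forall>i\<in>Y - ?N. (\<Sum>y\<in>X. adj E i y) = 0"
      by (auto simp: adj_def insert_commute intro!: sum.neutral)
  qed (use assms in auto)
  also have "\<dots> \<le> D * card ?N" by (rule cut_size_le_degree) (use assms in auto)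
  finally show ?thesis .
qed

lemma spans_connected_singleton: "spans_connected E {x}"
  by (simp add: spans_connected_def)

lemma spans_connected_mono: "spans_connected E W \<Longrightarrow> E \<subseteq> E' \<Longrightarrow> spans_connected E' W"
  using rtrancl_mono[of "{(u, v). u \<in> W \<and> v \<in> W \<and> {u, v} \<in> E}"
      "{(u, v). u \<in> W \<and> v \<in> W \<and> {u, v} \<in> E'}"]
  unfolding spans_connected_def by blast

lemma spans_connected_insert:
  assumes W: "spans_connected E W" and w: "w \<in> W" "{w, v} \<in> E"
  shows "spans_connected E (insert v W)"
proof -
  let ?r = "\<lambda>W. {(u, v). u \<in> W \<and> v \<in> W \<and> {u, v} \<in> E}"
  have mono: "(?r W)\<^sup>* \<subseteq> (?r (insert v W))\<^sup>*" by (intro rtrancl_mono) auto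
  have vw: "(v, w) \<in> (?r (insert v W))\<^sup>*" "(w, v) \<in> (?r (insert v W))\<^sup>*"
    using w by (auto simp: insert_commute)
  have WW: "(x, y) \<in> (?r (insert v W))\<^sup>*" if "x \<in> W" "y \<in> W" for x y
    using W mono that unfolding spans_connected_def by blast
  have "(x, y) \<in> (?r (insert v W))\<^sup>*" if "x \<in> insert v W" "y \<in> insert v W" for x y
  proof (cases "x = v"; cases "y = v")
    assume "x = v" "y = v"
    then show ?thesis by simp
  next
    assume "x = v" "y \<noteq> v"
    then show ?thesis using that vw(1) WW[OF w(1), of y] by (auto intro: rtrancl_trans)
  next
    assume "x \<noteq> v" "y = v"
    then show ?thesis using that vw(2) WW[OF _ w(1), of x] by (auto intro: rtrancl_trans)
  next
    assume "x \<noteq> v" "y \<noteq> v"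
    then show ?thesis using that WW by auto
  qed
  then show ?thesis unfolding spans_connected_def by blast
qed

lemma ex_median:
  fixes f :: "'a \<Rightarrow> real"
  assumes "finite R" "R \<noteq> {}"
  shows "\<exists>m. 2 * card {x \<in> R. m < f x} \<le> card R \<and> 2 * card {x \<in> R. f x < m} \<le> card R"
proof -
  \<comment> \<open>The median is the least value that at most half of the elements exceed. The next
    smaller value \<open>p\<close>, if any, is exceeded by more than half, and all elements below
    the median lie at or below \<open>p\<close>.\<close>
  define M where "M = {m \<in> f ` R. 2 * card {x \<in> R. m < f x} \<le> card R}"
  have fin: "finite M" using assms by (simp add: M_def)
  have empty: "{x \<in> R. Max (f ` R) < f x} = {}" using assms
    by (metis (mono_tags, lifting) Max_ge empty_Collect_eq finite_imageI imageI linorder_not_less)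
  have "Max (f ` R) \<in> f ` R" using assms by (intro Max_in) auto
  then have "Max (f ` R) \<in> M" unfolding M_def mem_Collect_eq empty by simp
  then have m: "Min M \<in> M" using fin by (intro Min_in) auto
  define m where "m = Min M"
  have "2 * card {x \<in> R. f x < m} \<le> card R"
  proof (cases "{x \<in> R. f x < m} = {}")
    case False
    define L where "L = {x \<in> R. f x < m}"
    define p where "p = Max (f ` L)"
    have L: "finite L" "L \<noteq> {}" using assms False by (auto simp: L_def)
    then have p: "p \<in> f ` L" unfolding p_def by (intro Max_in) auto
    then have "p < m" by (auto simp: L_def)
    then have "p \<notin> M" unfolding m_def using fin by (meson Min_le linorder_not_less)
    then have big: "card R < 2 * card {x \<in> R. p < f x}" using p by (auto simp: M_def L_def)
    have "{x \<in> R. p < f x} \<subseteq> R - L"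
      using L by (auto simp: p_def)
    then have "card {x \<in> R. p < f x} \<le> card R - card L"
      using assms(1) L by (metis (no_types, lifting) card_Diff_subset card_mono finite_Diff L_def mem_Collect_eq subsetI)
    moreover have "card L \<le> card R" using assms(1) by (intro card_mono) (auto simp: L_def)
    ultimately show ?thesis using big unfolding L_def[symmetric] by linarith
  next
    case True
    show ?thesis unfolding True by simp
  qed
  then show ?thesis using m unfolding M_def m_def by blast
qed

section \<open>Expanders and Cheeger's inequality\<close>

locale expander =
  fixes R :: "'a set" and E :: "'a set set" and D h :: real
  assumes fin: "finite R" and ne: "R \<noteq> {}" and D_pos: "0 < D" and h_pos: "0 < h"
    and degree: "\<And>x. x \<in> R \<Longrightarrow> (\<Sum>y\<in>R. adj E x y) \<le> D"
    and expansion: "\<And>W. W \<subseteq> R \<Longrightarrow> 2 * card W \<le> card R \<Longrightarrow> h * D * card W \<le> cut_size E W (R - W)"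
begin

abbreviation "a \<equiv> adj E"

text \<open>The Dirichlet form of the graph, with every edge counted in both directions.\<close>

definition energy :: "('a \<Rightarrow> real) \<Rightarrow> real" where
  "energy f = (\<Sum>x\<in>R. \<Sum>y\<in>R. a x y * (f x - f y)\<^sup>2)"

lemma card_pos: "0 < card R"
  using fin ne by (simp add: card_gt_0_iff)

text \<open>Layer by layer: the expansion of the support \<open>L\<close> accounts for the lowest
  positive value \<open>m\<close>, and subtracting \<open>m\<close> on \<open>L\<close> leaves a
  function of smaller support.\<close>

lemma coarea:
  assumes "\<And>x. x \<in> R \<Longrightarrow> 0 \<le> F x" "2 * card {x \<in> R. 0 < F x} \<le> card R"
  shows "h * D * (\<Sum>x\<in>R. F x) \<le> (\<Sum>x\<in>R. \<Sum>y\<in>R. a x y * max 0 (F x - F y))"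
  using assms
proof (induction "card {x \<in> R. 0 < F x}" arbitrary: F rule: less_induct)
  case less
  define L where "L = {x \<in> R. 0 < F x}"
  have L: "L \<subseteq> R" "finite L" using fin by (auto simp: L_def)
  show ?case
  proof (cases "L = {}")
    case True
    then have "F x = 0" if "x \<in> R" for x using less.prems(1)[OF that] that
      by (force simp: L_def)
    then show ?thesis by (simp add: sum_nonneg)
  next
    case False
    define m where "m = Min (F ` L)"
    have mL: "m \<in> F ` L" unfolding m_def using L False by (intro Min_in) auto
    then have m: "0 < m" by (auto simp: L_def)
    have mle: "m \<le> F x" if "x \<in> L" for x unfolding m_def using L that by simp
    define G where "G x = (if x \<in> L then F x - m else 0)" for x
    have F: "F x = G x + m * of_bool (x \<in> L)" if "x \<in> R" for x
      using that less.prems(1)[OF that] by (force simp: G_def L_def)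
    have sub: "{x \<in> R. 0 < G x} \<subseteq> L" by (auto simp: G_def)
    obtain z where "z \<in> L" "F z = m" using mL by auto
    then have "z \<in> L - {x \<in> R. 0 < G x}" by (simp add: G_def)
    then have psub: "{x \<in> R. 0 < G x} \<subset> L" using sub by blast
    then have less': "card {x \<in> R. 0 < G x} < card {x \<in> R. 0 < F x}"
      using L unfolding L_def[symmetric] by (intro psubset_card_mono) auto
    have IH: "h * D * (\<Sum>x\<in>R. G x) \<le> (\<Sum>x\<in>R. \<Sum>y\<in>R. a x y * max 0 (G x - G y))"
      by (rule less.hyps[OF less']) (use less' less.prems(2) mle in \<open>auto simp: G_def\<close>)
    have "(\<Sum>x\<in>R. F x) = (\<Sum>x\<in>R. G x) + m * card L"
    proof -
      have "(\<Sum>x\<in>R. F x) = (\<Sum>x\<in>R. G x + m * of_bool (x \<in> L))"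
        by (intro sum.cong) (auto simp: F)
      also have "\<dots> = (\<Sum>x\<in>R. G x) + m * (\<Sum>x\<in>R. of_bool (x \<in> L))"
        by (simp add: sum.distrib sum_distrib_left)
      also have "(\<Sum>x\<in>R. of_bool (x \<in> L)) = real (card L)"
        using fin L by (simp add: Int_absorb1 flip: Int_def)
      finally show ?thesis .
    qed
    moreover have "(\<Sum>x\<in>R. \<Sum>y\<in>R. a x y * max 0 (F x - F y))
        = (\<Sum>x\<in>R. \<Sum>y\<in>R. a x y * max 0 (G x - G y)) + m * cut_size E L (R - L)"
    proof -
      \<comment> \<open>Lowering \<open>F\<close> by \<open>m\<close> on \<open>L\<close> changes
        the positive part of a difference only along pairs that leave \<open>L\<close>.\<close>
      have "max 0 (F x - F y) = max 0 (G x - G y) + m * (of_bool (x \<in> L) * of_bool (y \<in> R - L))"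
        if "x \<in> R" "y \<in> R" for x y
        using F[OF that(1)] F[OF that(2)] mle[of x] mle[of y] m that
        by (auto simp: G_def max_def)
      then have "(\<Sum>x\<in>R. \<Sum>y\<in>R. a x y * max 0 (F x - F y))
        = (\<Sum>x\<in>R. \<Sum>y\<in>R. a x y * max 0 (G x - G y) + m * (of_bool (x \<in> L) * (of_bool (y \<in> R - L) * a x y)))"
        by (intro sum.cong) (auto simp: algebra_simps)
      also have "\<dots> = (\<Sum>x\<in>R. \<Sum>y\<in>R. a x y * max 0 (G x - G y))
          + m * (\<Sum>x\<in>R. of_bool (x \<in> L) * (\<Sum>y\<in>R. of_bool (y \<in> R - L) * a x y))"
        by (simp add: sum.distrib sum_distrib_left)
      also have "(\<Sum>x\<in>R. of_bool (x \<in> L) * (\<Sum>y\<in>R. of_bool (y \<in> R - L) * a x y)) = cut_size E L (R - L)"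
        unfolding cut_size_def using fin L
        by (intro sum.mono_neutral_cong_right) (auto intro!: sum.mono_neutral_cong_right)
      finally show ?thesis .
    qed
    moreover have "m * (h * D * card L) \<le> m * cut_size E L (R - L)"
      using expansion[of L] L less.prems(2) m unfolding L_def[symmetric] by (intro mult_left_mono) auto
    ultimately show ?thesis using IH by (simp add: algebra_simps)
  qed
qed

lemma sum_adj_mult_le:
  assumes "\<And>x. x \<in> R \<Longrightarrow> 0 \<le> w x"
  shows "(\<Sum>x\<in>R. \<Sum>y\<in>R. a x y * w x) \<le> D * (\<Sum>x\<in>R. w x)"
proof -
  have "(\<Sum>x\<in>R. (\<Sum>y\<in>R. a x y) * w x) \<le> (\<Sum>x\<in>R. D * w x)"
    using assms degree by (intro sum_mono mult_right_mono) auto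
  then show ?thesis by (simp add: sum_distrib_left sum_distrib_right)
qed

lemma sum_adj_swap: "(\<Sum>x\<in>R. \<Sum>y\<in>R. a x y * f y x) = (\<Sum>x\<in>R. \<Sum>y\<in>R. a x y * f x y)"
  by (subst sum.swap) (simp add: adj_commute)

text \<open>The coarea bound is applied to the square of \<open>g\<close>. A difference of squares
  is a difference times a sum, so Cauchy-Schwarz bounds the square of the variation \<open>T\<close>
  by \<open>energy g * (4 * D * G)\<close>, and one factor \<open>G\<close> cancels.\<close>

lemma energy_ge_small_support:
  assumes "\<And>x. x \<in> R \<Longrightarrow> 0 \<le> g x" "2 * card {x \<in> R. 0 < g x} \<le> card R"
  shows "h\<^sup>2 * D * (\<Sum>x\<in>R. (g x)\<^sup>2) \<le> energy g"
proof -
  define G where "G = (\<Sum>x\<in>R. (g x)\<^sup>2)"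
  define T where "T = (\<Sum>x\<in>R. \<Sum>y\<in>R. a x y * \<bar>(g x)\<^sup>2 - (g y)\<^sup>2\<bar>)"
  have G0: "0 \<le> G" unfolding G_def by (intro sum_nonneg) auto
  have E0: "0 \<le> energy g" unfolding energy_def by (intro sum_nonneg) auto
  have "{x \<in> R. 0 < (g x)\<^sup>2} = {x \<in> R. 0 < g x}" using assms(1) by force
  then have 1: "h * D * G \<le> (\<Sum>x\<in>R. \<Sum>y\<in>R. a x y * max 0 ((g x)\<^sup>2 - (g y)\<^sup>2))"
    unfolding G_def using assms(2) by (intro coarea) auto
  have "T = (\<Sum>x\<in>R. \<Sum>y\<in>R. a x y * max 0 ((g x)\<^sup>2 - (g y)\<^sup>2) + a x y * max 0 ((g y)\<^sup>2 - (g x)\<^sup>2))"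
    unfolding T_def by (intro sum.cong refl) (auto simp: max_def)
  also have "\<dots> = 2 * (\<Sum>x\<in>R. \<Sum>y\<in>R. a x y * max 0 ((g x)\<^sup>2 - (g y)\<^sup>2))"
    using sum_adj_swap[of "\<lambda>x y. max 0 ((g x)\<^sup>2 - (g y)\<^sup>2)"] by (simp add: sum.distrib)
  finally have T1: "2 * (h * D * G) \<le> T" using 1 by simp
  have "T = (\<Sum>p\<in>R \<times> R. (a (fst p) (snd p) * \<bar>g (fst p) - g (snd p)\<bar>) * (a (fst p) (snd p) * (g (fst p) + g (snd p))))"
  proof -
    have "a x y * \<bar>(g x)\<^sup>2 - (g y)\<^sup>2\<bar> = a x y * \<bar>g x - g y\<bar> * (a x y * (g x + g y))"
      if "x \<in> R" "y \<in> R" for x y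
    proof -
      have "0 \<le> g x + g y" using assms(1) that by (simp add: add_nonneg_nonneg)
      then show ?thesis
        by (simp add: power2_eq_square square_diff_square_factored abs_mult adj_def)
    qed
    then show ?thesis unfolding T_def sum.cartesian_product by (intro sum.cong refl) auto
  qed
  then have "T\<^sup>2 \<le> (\<Sum>p\<in>R \<times> R. (a (fst p) (snd p) * \<bar>g (fst p) - g (snd p)\<bar>)\<^sup>2) *
      (\<Sum>p\<in>R \<times> R. (a (fst p) (snd p) * (g (fst p) + g (snd p)))\<^sup>2)"
    by (simp only:) (rule Cauchy_Schwarz_ineq_sum)
  also have "(\<Sum>p\<in>R \<times> R. (a (fst p) (snd p) * \<bar>g (fst p) - g (snd p)\<bar>)\<^sup>2) = energy g"
    unfolding energy_def sum.cartesian_product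
    by (intro sum.cong refl) (auto simp: adj_def)
  also have "(\<Sum>p\<in>R \<times> R. (a (fst p) (snd p) * (g (fst p) + g (snd p)))\<^sup>2)
      = (\<Sum>x\<in>R. \<Sum>y\<in>R. a x y * (g x + g y)\<^sup>2)"
    unfolding sum.cartesian_product by (intro sum.cong refl) (auto simp: adj_def)
  also have "\<dots> \<le> (\<Sum>x\<in>R. \<Sum>y\<in>R. a x y * (2 * (g x)\<^sup>2) + a x y * (2 * (g y)\<^sup>2))"
  proof (intro sum_mono)
    fix x y
    have "(g x + g y)\<^sup>2 \<le> 2 * (g x)\<^sup>2 + 2 * (g y)\<^sup>2"
      using zero_le_power2[of "g x - g y"] by (simp add: power2_eq_square algebra_simps)
    then have "a x y * (g x + g y)\<^sup>2 \<le> a x y * (2 * (g x)\<^sup>2 + 2 * (g y)\<^sup>2)"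
      by (intro mult_left_mono) auto
    then show "a x y * (g x + g y)\<^sup>2 \<le> a x y * (2 * (g x)\<^sup>2) + a x y * (2 * (g y)\<^sup>2)"
      by (simp add: algebra_simps)
  qed
  also have "\<dots> = 2 * (\<Sum>x\<in>R. \<Sum>y\<in>R. a x y * (2 * (g x)\<^sup>2))"
    using sum_adj_swap[of "\<lambda>x y. 2 * (g x)\<^sup>2"] by (simp add: sum.distrib)
  also have "\<dots> \<le> 2 * (D * (\<Sum>x\<in>R. 2 * (g x)\<^sup>2))"
    by (intro mult_left_mono sum_adj_mult_le) auto
  also have "\<dots> = 4 * D * G" by (simp add: G_def sum_distrib_left algebra_simps)
  finally have 2: "T\<^sup>2 \<le> energy g * (4 * D * G)" using E0 by (simp add: mult_left_mono)
  have "(2 * (h * D * G))\<^sup>2 \<le> T\<^sup>2"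
    using T1 h_pos D_pos G0 by (intro power_mono) auto
  with 2 have 3: "(4 * D * G) * (h\<^sup>2 * D * G) \<le> (4 * D * G) * energy g"
    by (simp add: power2_eq_square algebra_simps)
  show ?thesis
  proof (cases "G = 0")
    case False
    then have "0 < 4 * D * G" using G0 D_pos by simp
    then show ?thesis using 3 unfolding G_def[symmetric] by (metis mult_le_cancel_left_pos)
  qed (use E0 G_def in simp)
qed

text \<open>Cheeger's inequality, applied to the parts of \<open>f\<close> above and below a median.\<close>

lemma energy_ge_deviation:
  "\<exists>m. h\<^sup>2 * D * (\<Sum>x\<in>R. (f x - m)\<^sup>2) \<le> energy f"
proof -
  obtain m where m: "2 * card {x \<in> R. m < f x} \<le> card R" "2 * card {x \<in> R. f x < m} \<le> card R"
    using ex_median[OF fin ne, of f] by blast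
  define p q where "p x = max 0 (f x - m)" and "q x = max 0 (m - f x)" for x
  have "{x \<in> R. 0 < p x} = {x \<in> R. m < f x}" "{x \<in> R. 0 < q x} = {x \<in> R. f x < m}"
    by (auto simp: p_def q_def)
  then have "h\<^sup>2 * D * (\<Sum>x\<in>R. (p x)\<^sup>2) + h\<^sup>2 * D * (\<Sum>x\<in>R. (q x)\<^sup>2) \<le> energy p + energy q"
    using m by (intro add_mono energy_ge_small_support) (auto simp: p_def q_def)
  moreover have "(\<Sum>x\<in>R. (f x - m)\<^sup>2) = (\<Sum>x\<in>R. (p x)\<^sup>2) + (\<Sum>x\<in>R. (q x)\<^sup>2)"
    unfolding sum.distrib[symmetric]
    by (intro sum.cong refl) (auto simp: p_def q_def max_def power2_commute)
  moreover have "energy p + energy q \<le> energy f"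
  proof -
    have "(p x - p y)\<^sup>2 + (q x - q y)\<^sup>2 \<le> (f x - f y)\<^sup>2" for x y
    proof -
      have "f x - f y = (p x - p y) - (q x - q y)" by (auto simp: p_def q_def max_def)
      moreover have "(p x - p y) * (q x - q y) \<le> 0"
        by (auto simp: p_def q_def max_def mult_nonneg_nonpos mult_nonpos_nonneg)
      moreover have "((p x - p y) - (q x - q y))\<^sup>2
          = (p x - p y)\<^sup>2 + (q x - q y)\<^sup>2 - 2 * ((p x - p y) * (q x - q y))"
        by (simp add: power2_diff)
      ultimately show ?thesis by simp
    qed
    then have "a x y * (p x - p y)\<^sup>2 + a x y * (q x - q y)\<^sup>2 \<le> a x y * (f x - f y)\<^sup>2" for x y
      by (metis adj_nonneg distrib_left mult_left_mono)
    then show ?thesis unfolding energy_def sum.distrib[symmetric] by (intro sum_mono)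
  qed
  ultimately show ?thesis by (intro exI[of _ m]) (simp add: algebra_simps)
qed

text \<open>A Poincare inequality with zero boundary values. Where \<open>f\<close> vanishes, its
  deviation from \<open>m\<close> has the size of \<open>m\<close>, so the total deviation controls
  \<open>m\<close> and with it the whole norm of \<open>f\<close>.\<close>

lemma energy_ge:
  assumes "S \<subseteq> R" "\<And>x. x \<in> S \<Longrightarrow> f x = 0"
  shows "h\<^sup>2 * D * card S * (\<Sum>x\<in>R. (f x)\<^sup>2) \<le> 4 * card R * energy f"
proof -
  obtain m where m: "h\<^sup>2 * D * (\<Sum>x\<in>R. (f x - m)\<^sup>2) \<le> energy f"
    using energy_ge_deviation by blast
  define V where "V = (\<Sum>x\<in>R. (f x - m)\<^sup>2)"
  have V0: "0 \<le> V" unfolding V_def by (intro sum_nonneg) auto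
  have "card S * m\<^sup>2 = (\<Sum>x\<in>S. (f x - m)\<^sup>2)" using assms(2) by simp
  also have "\<dots> \<le> V" unfolding V_def using fin assms(1) by (intro sum_mono2) auto
  finally have Sm: "card S * m\<^sup>2 \<le> V" .
  have "(\<Sum>x\<in>R. (f x)\<^sup>2) \<le> (\<Sum>x\<in>R. 2 * (f x - m)\<^sup>2 + 2 * m\<^sup>2)"
  proof (intro sum_mono)
    fix x
    show "(f x)\<^sup>2 \<le> 2 * (f x - m)\<^sup>2 + 2 * m\<^sup>2"
      using zero_le_power2[of "f x - 2 * m"] by (simp add: power2_eq_square algebra_simps)
  qed
  also have "\<dots> = 2 * V + 2 * card R * m\<^sup>2"
    by (simp add: V_def sum.distrib sum_distrib_left)
  finally have "card S * (\<Sum>x\<in>R. (f x)\<^sup>2) \<le> card S * (2 * V + 2 * card R * m\<^sup>2)"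
    by (intro mult_left_mono) auto
  also have "\<dots> = 2 * (card S * V) + 2 * card R * (card S * m\<^sup>2)" by (simp add: algebra_simps)
  also have "\<dots> \<le> 2 * (card R * V) + 2 * card R * V"
    using Sm V0 card_mono[OF fin assms(1)] by (intro add_mono mult_left_mono mult_right_mono) auto
  finally have 1: "card S * (\<Sum>x\<in>R. (f x)\<^sup>2) \<le> 4 * card R * V" by (simp add: algebra_simps)
  have "h\<^sup>2 * D * (card S * (\<Sum>x\<in>R. (f x)\<^sup>2)) \<le> h\<^sup>2 * D * (4 * card R * V)"
    using 1 D_pos by (intro mult_left_mono) auto
  also have "\<dots> = 4 * card R * (h\<^sup>2 * D * V)" by simp
  also have "\<dots> \<le> 4 * card R * energy f" using m unfolding V_def[symmetric] by (intro mult_left_mono) auto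
  finally show ?thesis by (simp add: algebra_simps)
qed

text \<open>One step of the lazy random walk that crosses each edge with probability \<open>1 / (2 * D)\<close>.\<close>

definition step :: "('a \<Rightarrow> real) \<Rightarrow> 'a \<Rightarrow> real" where
  "step f x = f x - (\<Sum>y\<in>R. a x y * (f x - f y)) / (2 * D)"

text \<open>With \<open>step f = f - g\<close>, the inner product of \<open>f\<close> and
  \<open>g\<close> is \<open>energy f / (4 * D)\<close>. The cross term of the square gains this
  amount twice; by laziness the squared norm of \<open>g\<close> gives it back at most once.\<close>

lemma step_norm: "(\<Sum>x\<in>R. (step f x)\<^sup>2) \<le> (\<Sum>x\<in>R. (f x)\<^sup>2) - energy f / (4 * D)"
proof -
  define g where "g x = (\<Sum>y\<in>R. a x y * (f x - f y)) / (2 * D)" for x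
  have "(\<Sum>x\<in>R. \<Sum>y\<in>R. a x y * (f x - f y)\<^sup>2)
      = (\<Sum>x\<in>R. \<Sum>y\<in>R. a x y * (f x * (f x - f y)) + a x y * (f y * (f y - f x)))"
    by (intro sum.cong refl) (simp add: power2_eq_square algebra_simps)
  also have "\<dots> = 2 * (\<Sum>x\<in>R. \<Sum>y\<in>R. a x y * (f x * (f x - f y)))"
    using sum_adj_swap[of "\<lambda>x y. f x * (f x - f y)"] by (simp add: sum.distrib)
  also have "(\<Sum>x\<in>R. \<Sum>y\<in>R. a x y * (f x * (f x - f y))) = (\<Sum>x\<in>R. 2 * D * (f x * g x))"
  proof (intro sum.cong refl)
    fix x
    have "2 * D * g x = (\<Sum>y\<in>R. a x y * (f x - f y))" using D_pos by (simp add: g_def)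
    then have "2 * D * (f x * g x) = f x * (\<Sum>y\<in>R. a x y * (f x - f y))"
      by (simp add: mult.left_commute mult.commute)
    then show "(\<Sum>y\<in>R. a x y * (f x * (f x - f y))) = 2 * D * (f x * g x)"
      by (simp add: sum_distrib_left mult.left_commute)
  qed
  also have "2 * (\<Sum>x\<in>R. 2 * D * (f x * g x)) = 4 * D * (\<Sum>x\<in>R. f x * g x)"
    by (simp add: sum_distrib_left mult.assoc)
  finally have fg: "(\<Sum>x\<in>R. f x * g x) = energy f / (4 * D)"
    using D_pos by (simp add: energy_def field_simps)
  have "(g x)\<^sup>2 \<le> (\<Sum>y\<in>R. a x y * (f x - f y)\<^sup>2) / (4 * D)" if "x \<in> R" for x
  proof -
    have "(\<Sum>y\<in>R. a x y * (f x - f y))\<^sup>2 = (\<Sum>y\<in>R. a x y * (a x y * (f x - f y)))\<^sup>2" by simp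
    also have "\<dots> \<le> (\<Sum>y\<in>R. (a x y)\<^sup>2) * (\<Sum>y\<in>R. (a x y * (f x - f y))\<^sup>2)"
      by (rule Cauchy_Schwarz_ineq_sum)
    also have "\<dots> = (\<Sum>y\<in>R. a x y) * (\<Sum>y\<in>R. a x y * (f x - f y)\<^sup>2)"
      by (simp add: power_mult_distrib)
    also have "\<dots> \<le> D * (\<Sum>y\<in>R. a x y * (f x - f y)\<^sup>2)"
      using degree[OF that] by (intro mult_right_mono sum_nonneg) auto
    finally have "(\<Sum>y\<in>R. a x y * (f x - f y))\<^sup>2 / (4 * D\<^sup>2) \<le> D * (\<Sum>y\<in>R. a x y * (f x - f y)\<^sup>2) / (4 * D\<^sup>2)"
      using D_pos by (intro divide_right_mono) auto
    then show ?thesis using D_pos by (simp add: g_def power_divide power2_eq_square)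
  qed
  then have "(\<Sum>x\<in>R. (g x)\<^sup>2) \<le> (\<Sum>x\<in>R. (\<Sum>y\<in>R. a x y * (f x - f y)\<^sup>2) / (4 * D))"
    by (intro sum_mono)
  then have gg: "(\<Sum>x\<in>R. (g x)\<^sup>2) \<le> energy f / (4 * D)"
    by (simp add: energy_def sum_divide_distrib)
  have "(\<Sum>x\<in>R. (step f x)\<^sup>2) = (\<Sum>x\<in>R. (f x)\<^sup>2 - 2 * (f x * g x) + (g x)\<^sup>2)"
    by (intro sum.cong refl) (simp add: step_def g_def[symmetric] power2_diff)
  also have "\<dots> = (\<Sum>x\<in>R. (f x)\<^sup>2) - 2 * (\<Sum>x\<in>R. f x * g x) + (\<Sum>x\<in>R. (g x)\<^sup>2)"
    by (simp add: sum.distrib sum_subtractf sum_distrib_left)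
  finally show ?thesis using fg gg by simp
qed

text \<open>\<open>surv S k x\<close> is the probability that \<open>k\<close> steps of the walk from \<open>x\<close> avoid \<open>S\<close>.\<close>

primrec surv :: "'a set \<Rightarrow> nat \<Rightarrow> 'a \<Rightarrow> real" where
  "surv S 0 x = of_bool (x \<notin> S)"
| "surv S (Suc k) x = (if x \<in> S then 0 else step (surv S k) x)"

lemma surv_eq_0: "x \<in> S \<Longrightarrow> surv S k x = 0"
  by (cases k) auto

text \<open>As \<open>surv S k\<close> vanishes on \<open>S\<close>, its energy is a fixed
  proportion of its squared norm, which therefore shrinks by a factor of at most
  \<open>1 - d\<close> per step. Resetting to 0 on \<open>S\<close> only helps.\<close>

lemma sum_surv_square_le:
  assumes "S \<subseteq> R"
  shows "(\<Sum>x\<in>R. (surv S k x)\<^sup>2) \<le> card R * exp (- (h\<^sup>2 * card S / (16 * card R)) * k)"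
proof (induction k)
  case 0
  have "(\<Sum>x\<in>R. (surv S 0 x)\<^sup>2) \<le> (\<Sum>x\<in>R. 1)" by (intro sum_mono) auto
  then show ?case by simp
next
  case (Suc k)
  define d where "d = h\<^sup>2 * card S / (16 * card R)"
  let ?f = "surv S k"
  define N where "N = (\<Sum>x\<in>R. (?f x)\<^sup>2)"
  have N0: "0 \<le> N" unfolding N_def by (intro sum_nonneg) auto
  have "(\<Sum>x\<in>R. (surv S (Suc k) x)\<^sup>2) \<le> (\<Sum>x\<in>R. (step ?f x)\<^sup>2)"
    by (intro sum_mono) auto
  also have "\<dots> \<le> N - energy ?f / (4 * D)" unfolding N_def by (rule step_norm)
  also have "\<dots> \<le> N - d * N"
  proof -
    have "h\<^sup>2 * D * card S * N \<le> 4 * card R * energy ?f"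
      unfolding N_def using assms by (intro energy_ge) (auto simp: surv_eq_0)
    then have "d * N \<le> energy ?f / (4 * D)"
      using D_pos card_pos by (simp add: d_def field_simps)
    then show ?thesis by simp
  qed
  also have "\<dots> = N * (1 + - d)" by (simp add: algebra_simps)
  also have "\<dots> \<le> N * exp (- d)" using N0 by (intro mult_left_mono exp_ge_add_one_self)
  also have "\<dots> \<le> card R * exp (- d * k) * exp (- d)"
    using Suc.IH unfolding N_def d_def[symmetric] by (intro mult_right_mono) auto
  also have "\<dots> = card R * exp (- d * Suc k)"
    by (simp add: exp_add[symmetric] algebra_simps)
  finally show ?case unfolding d_def .
qed

lemma sum_surv_le:
  assumes "S \<subseteq> R"
  shows "(\<Sum>x\<in>R. surv S k x) \<le> card R * exp (- (h\<^sup>2 * card S * k / (32 * card R)))"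
proof (rule power2_le_imp_le)
  have "(\<Sum>x\<in>R. surv S k x)\<^sup>2 = (\<Sum>x\<in>R. 1 * surv S k x)\<^sup>2" by simp
  also have "\<dots> \<le> (\<Sum>x\<in>R. 1\<^sup>2) * (\<Sum>x\<in>R. (surv S k x)\<^sup>2)" by (rule Cauchy_Schwarz_ineq_sum)
  also have "\<dots> \<le> card R * (card R * exp (- (h\<^sup>2 * card S / (16 * card R)) * k))"
    using sum_surv_square_le[OF assms] by (simp add: mult_left_mono)
  also have "\<dots> = (card R * exp (- (h\<^sup>2 * card S * k / (32 * card R))))\<^sup>2"
    by (simp add: power2_eq_square exp_add[symmetric] field_simps)
  finally show "(\<Sum>x\<in>R. surv S k x)\<^sup>2 \<le> (card R * exp (- (h\<^sup>2 * card S * k / (32 * card R))))\<^sup>2" .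
qed auto

text \<open>The value \<open>step f x\<close> is an average of \<open>f\<close> over
  \<open>x\<close> and its neighbours, and an average is never below all of its terms.\<close>

lemma step_average:
  assumes "x \<in> R"
  shows "\<exists>y\<in>R. (y = x \<or> {x, y} \<in> E) \<and> f y \<le> step f x"
proof (rule ccontr)
  assume "\<not> ?thesis"
  then have less: "step f x < f y" if "y \<in> R" "y = x \<or> {x, y} \<in> E" for y using that by force
  define s where "s = step f x"
  have "(\<Sum>y\<in>R. a x y * (f x - f y)) \<le> (\<Sum>y\<in>R. a x y * (f x - s))"
    using less by (intro sum_mono) (auto simp: adj_def s_def less_imp_le)
  also have "\<dots> = (\<Sum>y\<in>R. a x y) * (f x - s)" by (simp add: sum_distrib_right)
  also have "\<dots> \<le> D * (f x - s)"
    using degree[OF assms] less[OF assms] by (intro mult_right_mono) (auto simp: s_def)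
  also have "(\<Sum>y\<in>R. a x y * (f x - f y)) = 2 * (D * (f x - s))"
    using D_pos unfolding s_def step_def by simp
  finally have "D * (f x - s) \<le> 0" by simp
  then have "f x \<le> s" using D_pos by (simp add: mult_le_0_iff)
  then show False using less[OF assms] by (simp add: s_def)
qed

lemma step_sum: "step (\<lambda>x. \<Sum>i\<in>J. f i x) x = (\<Sum>i\<in>J. step (f i) x)"
proof -
  have "(\<Sum>y\<in>R. a x y * ((\<Sum>i\<in>J. f i x) - (\<Sum>i\<in>J. f i y))) = (\<Sum>i\<in>J. \<Sum>y\<in>R. a x y * (f i x - f i y))"
    by (subst sum.swap) (simp add: sum_distrib_left sum_subtractf[symmetric])
  then show ?thesis by (simp add: step_def sum_subtractf sum_divide_distrib)
qed

text \<open>The walk is derandomised by the method of conditional expectations.\<close>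

lemma ex_walk:
  assumes "finite J" "x \<in> R"
  shows "\<exists>W \<subseteq> R. x \<in> W \<and> spans_connected E W \<and> card W \<le> k + 1 \<and>
     card {i \<in> J. W \<inter> T i = {}} \<le> (\<Sum>i\<in>J. surv (T i) k x)"
  using assms
proof (induction k arbitrary: x J)
  case 0
  have "real (card {i \<in> J. {x} \<inter> T i = {}}) = (\<Sum>i\<in>J. surv (T i) 0 x)"
    using 0 by (simp add: Int_def)
  then show ?case using 0 by (intro exI[of _ "{x}"]) (auto simp: spans_connected_singleton)
next
  case (Suc k)
  define I where "I = {i \<in> J. x \<notin> T i}"
  have "(\<Sum>i\<in>J. surv (T i) (Suc k) x) = (\<Sum>i\<in>I. step (surv (T i) k) x)"
    using Suc.prems by (intro sum.mono_neutral_cong_right) (auto simp: I_def)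
  also have "\<dots> = step (\<lambda>x. \<Sum>i\<in>I. surv (T i) k x) x" by (simp add: step_sum)
  finally obtain y where y: "y \<in> R" "y = x \<or> {x, y} \<in> E"
    "(\<Sum>i\<in>I. surv (T i) k y) \<le> (\<Sum>i\<in>J. surv (T i) (Suc k) x)"
    using step_average[OF Suc.prems(2), of "\<lambda>x. \<Sum>i\<in>I. surv (T i) k x"] by metis
  have "finite I" using Suc.prems by (simp add: I_def)
  from Suc.IH[OF this y(1)] obtain W where W: "W \<subseteq> R" "y \<in> W" "spans_connected E W"
    "card W \<le> k + 1" "card {i \<in> I. W \<inter> T i = {}} \<le> (\<Sum>i\<in>I. surv (T i) k y)"
    by blast
  have "spans_connected E (insert x W)"
    using y(2) W spans_connected_insert[of E W y x] by (auto simp: insert_absorb insert_commute)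
  moreover have "card (insert x W) \<le> Suc k + 1" 
    using W(4) card_insert_le_m1[of "Suc (Suc k)" W x] by simp
  moreover have "{i \<in> J. insert x W \<inter> T i = {}} = {i \<in> I. W \<inter> T i = {}}" by (auto simp: I_def)
  ultimately show ?case using W y Suc.prems by (intro exI[of _ "insert x W"]) auto
qed

text \<open>The start is derandomised too: for a uniform start in \<open>R\<close>, the expected
  number of missed targets is at most the bound.\<close>

lemma ex_hitting_walk:
  assumes "finite J" "\<And>i. i \<in> J \<Longrightarrow> T i \<subseteq> R"
  shows "\<exists>W \<subseteq> R. spans_connected E W \<and> card W \<le> k + 1 \<and>
     card {i \<in> J. W \<inter> T i = {}} \<le> (\<Sum>i\<in>J. exp (- (h\<^sup>2 * card (T i) * k / (32 * card R))))"
proof -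
  let ?B = "\<Sum>i\<in>J. exp (- (h\<^sup>2 * card (T i) * k / (32 * card R)))"
  have "\<exists>x\<in>R. (\<Sum>i\<in>J. surv (T i) k x) \<le> ?B"
  proof (rule ccontr)
    assume "\<not> ?thesis"
    then have "(\<Sum>x\<in>R. ?B) < (\<Sum>x\<in>R. \<Sum>i\<in>J. surv (T i) k x)"
      by (intro sum_strict_mono[OF fin ne]) (simp add: not_le)
    also have "\<dots> = (\<Sum>i\<in>J. \<Sum>x\<in>R. surv (T i) k x)" by (rule sum.swap)
    also have "\<dots> \<le> (\<Sum>i\<in>J. card R * exp (- (h\<^sup>2 * card (T i) * k / (32 * card R))))"
      using assms(2) by (intro sum_mono sum_surv_le)
    finally show False by (simp add: sum_distrib_left)
  qed
  then obtain x where x: "x \<in> R" "(\<Sum>i\<in>J. surv (T i) k x) \<le> ?B" by blast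
  then show ?thesis using ex_walk[OF assms(1) x(1), of k T] by (meson order_trans)
qed

end

section \<open>Balls and connected sets that meet many targets\<close>

lemma exp_square_decay:
  fixes x :: real
  assumes "0 < c" "0 \<le> x"
  shows "x\<^sup>2 * exp (- (c * x)) \<le> 2 / c\<^sup>2"
proof -
  have "(c * x)\<^sup>2 / 2 \<le> exp (c * x)"
    using exp_lower_Taylor_quadratic[of "c * x"] mult_nonneg_nonneg[of c x] assms by linarith
  then have "(c * x)\<^sup>2 / 2 * exp (- (c * x)) \<le> exp (c * x) * exp (- (c * x))"
    by (intro mult_right_mono) auto
  then show ?thesis using assms by (simp add: exp_minus field_simps)
qed

text \<open>Bounds the expected distance of the walk from one target. The geometric series, of ratio
  \<open>exp (- (h ^ 4 / 32))\<close>, belongs to the balls that are still growing. The second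
  summand bounds \<open>r^2 * exp (- (h^2 / 64 * r))\<close>, the share of the at most
  \<open>r^2\<close> balls that fill half of \<open>R\<close>.\<close>

definition path_cost :: "real \<Rightarrow> real" where
  "path_cost h = 1 / (1 - exp (- (h ^ 4 / 32))) + 2 / (h\<^sup>2 / 64)\<^sup>2"

lemma path_cost_nonneg: "0 \<le> path_cost h"
  unfolding path_cost_def by (intro add_nonneg_nonneg divide_nonneg_nonneg) auto

context expander
begin

primrec ball :: "'a set \<Rightarrow> nat \<Rightarrow> 'a set" where
  "ball N 0 = N"
| "ball N (Suc i) = ball N i \<union> {y \<in> R. \<exists>x\<in>ball N i. {x, y} \<in> E}"

lemma ball_subset: "N \<subseteq> R \<Longrightarrow> ball N i \<subseteq> R"
  by (induction i) auto

lemma subset_ball: "N \<subseteq> ball N i"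
  by (induction i) auto

text \<open>The smaller side of the cut expands, so an expander is connected.\<close>

lemma cut_pos:
  assumes "W \<subseteq> R" "W \<noteq> {}" "W \<noteq> R"
  shows "0 < cut_size E W (R - W)"
proof -
  have fW: "finite W" using assms fin finite_subset by blast
  have "card W + card (R - W) = card R"
    using assms fW fin by (simp add: card_Diff_subset card_mono)
  then consider "2 * card W \<le> card R" | "2 * card (R - W) \<le> card R" by linarith
  then show ?thesis
  proof cases
    case 1
    have "0 < h * D * card W" using h_pos D_pos fW assms by (simp add: card_gt_0_iff)
    then show ?thesis using expansion[OF assms(1) 1] by linarith
  next
    case 2
    have "0 < h * D * card (R - W)" using h_pos D_pos fin assms by (simp add: card_gt_0_iff)
    moreover have "R - (R - W) = W" using assms by blast
    ultimately show ?thesis using expansion[OF _ 2] by (simp add: cut_size_commute)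
  qed
qed

lemma card_new_neighbours:
  assumes "W \<subseteq> R" "2 * card W \<le> card R"
  shows "h * card W \<le> card {y \<in> R - W. \<exists>x\<in>W. {x, y} \<in> E}"
proof -
  have "h * D * card W \<le> cut_size E W (R - W)" by (rule expansion[OF assms])
  also have "\<dots> \<le> D * card {y \<in> R - W. \<exists>x\<in>W. {x, y} \<in> E}"
  proof (rule cut_size_le_card_neighbours)
    show "(\<Sum>x\<in>W. adj E y x) \<le> D" if "y \<in> R - W" for y
      using that assms(1) fin by (intro order_trans[OF sum_mono2 degree]) auto
  qed (use assms fin finite_subset in auto)
  finally have "D * (h * card W) \<le> D * card {y \<in> R - W. \<exists>x\<in>W. {x, y} \<in> E}"
    by (simp add: mult.commute mult.left_commute)
  then show ?thesis using D_pos by (simp only: mult_le_cancel_left_pos)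
qed

text \<open>Each layer adds at least \<open>h * card N\<close> vertices until half of
  \<open>R\<close> is reached. This linear growth already makes the probability of missing a ball
  decay geometrically in the radius.\<close>

lemma ball_growth:
  assumes "N \<subseteq> R"
  shows "min (card R / 2) (card N * (1 + h * i)) \<le> card (ball N i)"
proof (induction i)
  case (Suc i)
  let ?B = "ball N i" and ?S = "{y \<in> R - ball N i. \<exists>x\<in>ball N i. {x, y} \<in> E}"
  have B: "?B \<subseteq> R" "finite ?B" using ball_subset[OF assms] fin finite_subset by blast+
  have eq: "ball N (Suc i) = ?B \<union> ?S" by auto
  have card: "card (ball N (Suc i)) = card ?B + card ?S"
    unfolding eq using B fin by (intro card_Un_disjoint) auto
  show ?case
  proof (cases "2 * card ?B \<le> card R")
    case True
    have "h * card N \<le> h * card ?B"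
      using subset_ball[of N i] B h_pos by (intro mult_left_mono) (auto intro: card_mono)
    also have "\<dots> \<le> card ?S" using card_new_neighbours[OF B(1) True] .
    finally have "h * card N \<le> card ?S" .
    then show ?thesis using Suc.IH card by (auto simp: algebra_simps min_le_iff_disj)
  next
    case False
    then have "card R / 2 \<le> card (ball N (Suc i))" using card by simp
    then show ?thesis by simp
  qed
qed simp

text \<open>By connectedness a ball short of \<open>R\<close> gains a vertex per step. The crude
  radius merely bounds the range of distances; their sum is controlled by the walk.\<close>

lemma ball_card_eq:
  assumes "N \<subseteq> R" "N \<noteq> {}"
  shows "ball N (card R) = R"
proof -
  have "min (card R) (Suc i) \<le> card (ball N i)" for i
  proof (induction i)
    case 0
    have "0 < card N" using assms fin finite_subset[of N R] by (simp add: card_gt_0_iff)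
    then show ?case by simp
  next
    case (Suc i)
    let ?B = "ball N i"
    have B: "?B \<subseteq> R" "finite (ball N (Suc i))" "?B \<noteq> {}"
      using ball_subset[OF assms(1)] fin finite_subset subset_ball[of N i] assms(2) by blast+
    have sub: "?B \<subseteq> ball N (Suc i)" by auto
    show ?case
    proof (cases "?B = R")
      case True
      then have "card R \<le> card (ball N (Suc i))" using card_mono[OF B(2) sub] by simp
      then show ?thesis by simp
    next
      case False
      obtain x y where "x \<in> ?B" "y \<in> R - ?B" "{x, y} \<in> E"
        using cut_size_pos_imp_edge[OF cut_pos[OF B(1,3) False]] by blast
      then have "?B \<subset> ball N (Suc i)" by auto
      then have "card ?B < card (ball N (Suc i))" by (rule psubset_card_mono[OF B(2)])
      then show ?thesis using Suc.IH by simp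
    qed
  qed
  from this[of "card R"] have "card R \<le> card (ball N (card R))" by simp
  then show ?thesis using ball_subset[OF assms(1)] fin by (intro card_seteq) auto
qed

text \<open>A path is traced inwards through the balls, at a cost of at most one vertex per unit of
  radius.\<close>

lemma connect_to_ball:
  assumes "W \<subseteq> R" "spans_connected E W" "W \<inter> ball N i \<noteq> {}" "N \<subseteq> R"
  shows "\<exists>W' \<subseteq> R. W \<subseteq> W' \<and> spans_connected E W' \<and> W' \<inter> N \<noteq> {} \<and> card W' \<le> card W + i"
  using assms
proof (induction i arbitrary: W)
  case (Suc i)
  show ?case
  proof (cases "W \<inter> ball N i = {}")
    case True
    then obtain y x where y: "y \<in> W" "x \<in> ball N i" "{x, y} \<in> E" using Suc.prems(3) by auto
    have conn: "spans_connected E (insert x W)"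
      using Suc.prems(2) y by (intro spans_connected_insert[of E W y]) (auto simp: insert_commute)
    have xR: "x \<in> R" using ball_subset[OF Suc.prems(4)] y by blast
    obtain W' where "W' \<subseteq> R" "insert x W \<subseteq> W'" "spans_connected E W'" "W' \<inter> N \<noteq> {}"
      "card W' \<le> card (insert x W) + i"
      using Suc.IH[OF _ conn _ Suc.prems(4)] Suc.prems(1) xR y(2) by blast
    moreover have "card (insert x W) \<le> card W + 1" by (simp add: card_insert_le_m1)
    ultimately show ?thesis by (intro exI[of _ W']) auto
  next
    case False
    then show ?thesis using Suc.IH[OF Suc.prems(1,2) _ Suc.prems(4)]
      by (metis le_SucI add_Suc_right)
  qed
qed auto

lemma connect_to_balls:
  assumes "finite J" "W \<subseteq> R" "spans_connected E W"
    and "\<And>j. j \<in> J \<Longrightarrow> N j \<subseteq> R \<and> W \<inter> ball (N j) (d j) \<noteq> {}"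
  shows "\<exists>W' \<subseteq> R. W \<subseteq> W' \<and> spans_connected E W' \<and> (\<forall>j\<in>J. W' \<inter> N j \<noteq> {})
     \<and> card W' \<le> card W + (\<Sum>j\<in>J. d j)"
  using assms
proof (induction J rule: finite_induct)
  case (insert j J)
  then obtain V where V: "V \<subseteq> R" "W \<subseteq> V" "spans_connected E V" "\<forall>j\<in>J. V \<inter> N j \<noteq> {}"
    "card V \<le> card W + (\<Sum>j\<in>J. d j)"
    by (metis insertCI)
  have "V \<inter> ball (N j) (d j) \<noteq> {}" "N j \<subseteq> R" using V(2) insert.prems by blast+
  from connect_to_ball[OF V(1,3) this] obtain W' where W': "W' \<subseteq> R" "V \<subseteq> W'" "spans_connected E W'"
    "W' \<inter> N j \<noteq> {}" "card W' \<le> card V + d j" by blast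
  have "\<forall>i\<in>insert j J. W' \<inter> N i \<noteq> {}" using W' V by blast
  moreover have "card W' \<le> card W + (\<Sum>j\<in>insert j J. d j)" using W' V insert.hyps by simp
  ultimately show ?case using W'(1,3) order_trans[OF V(2) W'(2)] by (intro exI[of _ W'] conjI)
qed auto

text \<open>Pads a branch set to \<open>r\<close> vertices, so that a shortage of neighbours means a
  small cut in proportion to its size.\<close>

lemma extend_connected:
  assumes "W \<subseteq> R" "spans_connected E W" "card W \<le> s" "s \<le> card R"
  shows "\<exists>W' \<subseteq> R. W \<subseteq> W' \<and> spans_connected E W' \<and> card W' = s"
  using assms(3,4)
proof (induction s rule: dec_induct)
  case base
  then show ?case using assms by blast
next
  case (step s)
  then obtain V where V: "V \<subseteq> R" "W \<subseteq> V" "spans_connected E V" "card V = s" by (metis Suc_leD)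
  have "V \<noteq> R" "V \<noteq> {}" using V step.prems by (auto simp: spans_connected_def)
  from cut_size_pos_imp_edge[OF cut_pos[OF V(1) this(2,1)]]
  obtain x y where xy: "x \<in> V" "y \<in> R - V" "{x, y} \<in> E" by blast
  have "spans_connected E (insert y V)" by (rule spans_connected_insert[OF V(3) xy(1,3)])
  moreover have "card (insert y V) = Suc s" using V xy fin finite_subset[of V R] by auto
  ultimately show ?case using V xy by (intro exI[of _ "insert y V"]) auto
qed

text \<open>The distance of the walk to \<open>N j\<close> is the number of balls around \<open>N j\<close> that it misses. These
  balls grow, so the probability of missing the \<open>i\<close>-th one decays geometrically and the expected
  distance is bounded.\<close>

lemma ex_connected_meeting:
  assumes J: "finite J" and N: "\<And>j. j \<in> J \<Longrightarrow> N j \<subseteq> R" "\<And>j. j \<in> J \<Longrightarrow> h * real r \<le> card (N j)"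
    and r: "1 \<le> r" "card R \<le> r\<^sup>2"
  shows "\<exists>W \<subseteq> R. spans_connected E W \<and> (\<forall>j\<in>J. W \<inter> N j \<noteq> {}) \<and>
     card W \<le> real r + 1 + path_cost h * card J"
proof -
  define L where "L = card R"
  \<comment> \<open>The targets are the balls of every radius below \<open>L\<close> around every
    \<open>N j\<close>, so that missed targets measure distances.\<close>
  define T where "T p = ball (N (fst p)) (snd p)" for p
  define q where "q = exp (- (h ^ 4 / 32))"
  have q: "0 < q" "q < 1" using h_pos by (auto simp: q_def)
  have L_pos: "0 < L" using card_pos by (simp add: L_def)
  have TR: "T p \<subseteq> R" if "p \<in> J \<times> {..<L}" for p
    unfolding T_def by (intro ball_subset N(1)) (use that in auto)
  have N_ne: "N j \<noteq> {}" if "j \<in> J" for j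
  proof
    assume "N j = {}"
    then show False using N(2)[OF that] h_pos r(1) by (auto simp: mult_le_0_iff)
  qed
  obtain W where W: "W \<subseteq> R" "spans_connected E W" "card W \<le> r + 1"
    "card {p \<in> J \<times> {..<L}. W \<inter> T p = {}} \<le> (\<Sum>p\<in>J \<times> {..<L}. exp (- (h\<^sup>2 * card (T p) * r / (32 * card R))))"
    using ex_hitting_walk[of "J \<times> {..<L}" T r] J TR by auto
  have bound: "exp (- (h\<^sup>2 * card (ball (N j) i) * r / (32 * card R)))
      \<le> q ^ i + exp (- (h\<^sup>2 / 64 * r))" if j: "j \<in> J" for j i
  proof -
    have "min (card R / 2) (card (N j) * (1 + h * i)) \<le> card (ball (N j) i)"
      by (rule ball_growth[OF N(1)[OF j]])
    then consider "card R / 2 \<le> card (ball (N j) i)" | "card (N j) * (1 + h * i) \<le> card (ball (N j) i)"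
      by linarith
    then show ?thesis
    proof cases
      case 1
      have "h\<^sup>2 / 64 * r = h\<^sup>2 * (card R / 2) * r / (32 * card R)" using card_pos by simp
      also have "\<dots> \<le> h\<^sup>2 * card (ball (N j) i) * r / (32 * card R)"
        using 1 by (intro divide_right_mono mult_right_mono mult_left_mono) auto
      finally have "exp (- (h\<^sup>2 * card (ball (N j) i) * r / (32 * card R))) \<le> exp (- (h\<^sup>2 / 64 * r))" by simp
      then show ?thesis using q by (smt (verit) zero_le_power)
    next
      case 2
      \<comment> \<open>Since \<open>card (N j)\<close> is at least \<open>h * r\<close> and
        \<open>r^2\<close> at least \<open>card R\<close>, the size of \<open>R\<close> cancels from
        the exponent, which leaves \<open>h ^ 4 / 32\<close> per unit of radius.\<close>
      have "h * r * (h * i) \<le> card (N j) * (1 + h * i)"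
        using N(2)[OF j] h_pos by (intro mult_mono) auto
      also note 2
      finally have B: "h * r * (h * i) \<le> card (ball (N j) i)" .
      have "h ^ 4 / 32 * i * real (card R) \<le> h ^ 4 / 32 * i * real (r\<^sup>2)"
        using r(2) h_pos by (intro mult_left_mono) (simp_all only: of_nat_le_iff, simp)
      also have "\<dots> = h\<^sup>2 * (h * r * (h * i)) * r / 32"
        by (simp add: power2_eq_square power4_eq_xxxx)
      also have "\<dots> \<le> h\<^sup>2 * card (ball (N j) i) * r / 32"
        using B by (intro divide_right_mono mult_right_mono mult_left_mono) auto
      finally have "h ^ 4 / 32 * i \<le> h\<^sup>2 * card (ball (N j) i) * r / (32 * card R)"
        using card_pos by (simp add: field_simps)
      then have "exp (- (h\<^sup>2 * card (ball (N j) i) * r / (32 * card R))) \<le> exp (- (h ^ 4 / 32 * i))" by simp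
      also have "\<dots> = q ^ i" by (simp add: q_def exp_of_nat_mult[symmetric] mult.commute)
      finally show ?thesis using exp_gt_zero[of "- (h\<^sup>2 / 64 * r)"] by linarith
    qed
  qed
  have "(\<Sum>p\<in>J \<times> {..<L}. exp (- (h\<^sup>2 * card (T p) * r / (32 * card R))))
      = (\<Sum>j\<in>J. \<Sum>i<L. exp (- (h\<^sup>2 * card (ball (N j) i) * r / (32 * card R))))"
    by (simp add: T_def sum.cartesian_product case_prod_beta)
  also have "\<dots> \<le> (\<Sum>j\<in>J. path_cost h)"
  proof (intro sum_mono)
    fix j assume j: "j \<in> J"
    have "(\<Sum>i<L. exp (- (h\<^sup>2 * card (ball (N j) i) * r / (32 * card R))))
        \<le> (\<Sum>i<L. q ^ i + exp (- (h\<^sup>2 / 64 * r)))"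
      using bound[OF j] by (intro sum_mono)
    also have "\<dots> = (\<Sum>i<L. q ^ i) + real L * exp (- (h\<^sup>2 / 64 * r))" by (simp add: sum.distrib)
    also have "(\<Sum>i<L. q ^ i) \<le> 1 / (1 - q)"
      using q by (simp add: sum_gp_strict divide_right_mono)
    also have "real L * exp (- (h\<^sup>2 / 64 * r)) \<le> (real r)\<^sup>2 * exp (- (h\<^sup>2 / 64 * r))"
      using r(2) unfolding L_def by (intro mult_right_mono) (simp_all flip: of_nat_power)
    also have "\<dots> \<le> 2 / (h\<^sup>2 / 64)\<^sup>2" using h_pos by (intro exp_square_decay) auto
    finally show "(\<Sum>i<L. exp (- (h\<^sup>2 * card (ball (N j) i) * r / (32 * card R)))) \<le> path_cost h"
      by (simp add: path_cost_def q_def)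
  qed
  finally have miss: "card {p \<in> J \<times> {..<L}. W \<inter> T p = {}} \<le> path_cost h * card J"
    using W(4) by (simp add: mult.commute)
  define d where "d j = (LEAST i. W \<inter> ball (N j) i \<noteq> {})" for j
  have W_ne: "W \<noteq> {}" using W(2) by (auto simp: spans_connected_def)
  have hit: "W \<inter> ball (N j) L \<noteq> {}" if "j \<in> J" for j
    using ball_card_eq[OF N(1)[OF that] N_ne[OF that]] W(1) W_ne by (auto simp: L_def)
  have d: "N j \<subseteq> R \<and> W \<inter> ball (N j) (d j) \<noteq> {}" if "j \<in> J" for j
    using N(1)[OF that] LeastI[of "\<lambda>i. W \<inter> ball (N j) i \<noteq> {}", OF hit[OF that]] by (simp add: d_def)
  have "\<exists>W' \<subseteq> R. W \<subseteq> W' \<and> spans_connected E W' \<and> (\<forall>j\<in>J. W' \<inter> N j \<noteq> {})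
     \<and> card W' \<le> card W + (\<Sum>j\<in>J. d j)"
    by (rule connect_to_balls[OF J W(1,2) d])
  then obtain W' where W': "W' \<subseteq> R" "spans_connected E W'"
    "\<forall>j\<in>J. W' \<inter> N j \<noteq> {}" "card W' \<le> card W + (\<Sum>j\<in>J. d j)" by blast
  \<comment> \<open>All balls of radius less than \<open>d j\<close> around \<open>N j\<close> are
    missed, so the total length of the detours is at most the number of missed targets.\<close>
  have "(\<Sum>j\<in>J. d j) = card (SIGMA j:J. {..<d j})" using J by (simp add: card_SigmaI)
  also have "\<dots> \<le> card {p \<in> J \<times> {..<L}. W \<inter> T p = {}}"
  proof (intro card_mono)
    have "d j \<le> L" if "j \<in> J" for j unfolding d_def by (rule Least_le[of "\<lambda>i. W \<inter> ball (N j) i \<noteq> {}", OF hit[OF that]])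
    moreover have "W \<inter> ball (N j) i = {}" if "i < d j" for i j
      using not_less_Least[of i "\<lambda>i. W \<inter> ball (N j) i \<noteq> {}"] that by (simp add: d_def)
    ultimately show "(SIGMA j:J. {..<d j}) \<subseteq> {p \<in> J \<times> {..<L}. W \<inter> T p = {}}"
      by (fastforce simp: T_def)
  qed (use J in simp)
  finally have "real (\<Sum>j\<in>J. d j) \<le> path_cost h * card J" using miss by linarith
  moreover have "real (card W') \<le> card W + real (\<Sum>j\<in>J. d j)" using W'(4) by linarith
  ultimately have "card W' \<le> real r + 1 + path_cost h * card J" using W(3) by linarith
  then show ?thesis using W'(1-3) by (intro exI[of _ W'] conjI)
qed

end

section \<open>Complete minors in expanders\<close>

text \<open>The measure \<open>card X * (t + 1) + card \<B>\<close> is maximised over pairs of a clique minor \<open>\<B>\<close> and a trash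
  set \<open>X\<close> that hardly expands into the rest \<open>R\<close>. At a maximum \<open>R\<close> is an expander into which every branch
  set has many neighbours, since otherwise a subset of \<open>R\<close> or a branch set could be moved to
  the trash; so a further branch set fits into \<open>R\<close>.\<close>

lemma ex_clique_minor:
  fixes U :: "'a set" and E :: "'a set set" and D \<theta> K :: real and r t :: nat
  defines "K \<equiv> 2 + path_cost (\<theta> / 8)"
  assumes finU: "finite U" and pos: "0 < D" "0 < \<theta>"
    and deg: "\<And>x. x \<in> U \<Longrightarrow> (\<Sum>y\<in>U. adj E x y) \<le> D"
    and cut: "\<And>W. W \<subseteq> U \<Longrightarrow> \<theta> * D * card W * card (U - W) / card U \<le> cut_size E W (U - W)"
    and r: "1 \<le> r" "card U \<le> r\<^sup>2" "4 * r \<le> 3 * card U"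
    and t: "t \<le> r" "64 * (t * (K * r)) \<le> \<theta> * card U" "8 * (t * (K * r)) \<le> card U"
  shows "\<exists>\<B>. finite \<B> \<and> card \<B> = t \<and> disjoint \<B> \<and> (\<forall>B\<in>\<B>. B \<subseteq> U \<and> spans_connected E B) \<and>
     (\<forall>B\<in>\<B>. \<forall>C\<in>\<B>. B \<noteq> C \<longrightarrow> (\<exists>x\<in>B. \<exists>y\<in>C. {x, y} \<in> E))"
proof -
  define u where "u = card U"
  have u: "0 < u" using r by (simp add: u_def)
  \<comment> \<open>The lower bound \<open>r\<close> makes a branch set with few neighbours fit for
    the trash, and the upper bound \<open>K * r\<close> keeps the union small. \<open>K * r\<close>
    has room for a walk of \<open>r + 1\<close> vertices and its detours.\<close>
  define fam where "fam \<B> \<longleftrightarrow> finite \<B> \<and> card \<B> \<le> t \<and> disjoint \<B> \<and>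
     (\<forall>B\<in>\<B>. B \<subseteq> U \<and> spans_connected E B \<and> r \<le> card B \<and> card B \<le> K * r) \<and>
     (\<forall>B\<in>\<B>. \<forall>C\<in>\<B>. B \<noteq> C \<longrightarrow> (\<exists>x\<in>B. \<exists>y\<in>C. {x, y} \<in> E))" for \<B>
  define valid where "valid p \<longleftrightarrow> (case p of (X, \<B>) \<Rightarrow> fam \<B> \<and> X \<subseteq> U \<and> X \<inter> \<Union>\<B> = {} \<and> 4 * card X \<le> 3 * u \<and>
     cut_size E X (U - X - \<Union>\<B>) \<le> \<theta> * D / 8 * card X)" for p
  \<comment> \<open>The factor \<open>t + 1\<close> makes the order lexicographic: with at most
    \<open>t\<close> branch sets, one more vertex of trash outweighs the loss of any of
    them.\<close>
  define \<mu> where "\<mu> p = (case p of (X, \<B>) \<Rightarrow> card X * (t + 1) + card \<B>)" for p :: "'a set \<times> 'a set set"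
  have "valid ({}, {})" by (simp add: valid_def fam_def cut_size_def)
  moreover have "\<forall>p. valid p \<longrightarrow> \<mu> p < Suc (u * (t + 1) + t)"
  proof (intro allI impI)
    fix p assume "valid p"
    then have "card (fst p) \<le> u" "card (snd p) \<le> t"
      using finU by (auto simp: valid_def fam_def u_def card_mono)
    then have "card (fst p) * (t + 1) + card (snd p) \<le> u * (t + 1) + t"
      by (intro add_mono mult_right_mono) auto
    then show "\<mu> p < Suc (u * (t + 1) + t)" by (simp add: \<mu>_def case_prod_beta)
  qed
  ultimately obtain p where "valid p" "\<And>p'. valid p' \<Longrightarrow> \<mu> p' \<le> \<mu> p"
    using ex_has_greatest_nat[of valid "({}, {})" \<mu>] by blast
  then obtain X \<B> where val: "valid (X, \<B>)" and max: "\<And>X' \<B>'. valid (X', \<B>') \<Longrightarrow> \<mu> (X', \<B>') \<le> \<mu> (X, \<B>)"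
    by (cases p) auto
  have \<B>: "fam \<B>" and X: "X \<subseteq> U" "X \<inter> \<Union>\<B> = {}" "4 * card X \<le> 3 * u"
    and cutX: "cut_size E X (U - X - \<Union>\<B>) \<le> \<theta> * D / 8 * card X"
    using val by (auto simp: valid_def)
  define Q R where "Q = \<Union>\<B>" and "R = U - X - Q"
  have QU: "Q \<subseteq> U" using \<B> by (auto simp: fam_def Q_def)
  have fins: "finite X" "finite Q" "finite R" "finite \<B>"
    using finite_subset[OF X(1) finU] finite_subset[OF QU finU] finU \<B> by (auto simp: R_def fam_def)
  have "real (card Q) \<le> (\<Sum>B\<in>\<B>. real (card B))"
    unfolding Q_def using card_Union_le_sum_card[of \<B>] by (simp flip: of_nat_sum)
  also have "\<dots> \<le> card \<B> * (K * r)"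
    using \<B> by (intro sum_bounded_above) (auto simp: fam_def)
  also have "\<dots> \<le> t * (K * r)"
  proof (intro mult_right_mono)
    show "real (card \<B>) \<le> real t" using \<B> by (simp add: fam_def)
    show "0 \<le> K * r"
    proof (cases "\<B> = {}")
      case False
      then obtain B where "B \<in> \<B>" by blast
      then have "real (card B) \<le> K * r" using \<B> by (auto simp: fam_def)
      then show ?thesis by (meson of_nat_0_le_iff order_trans)
    next
      case True
      show ?thesis using path_cost_nonneg[of "\<theta> / 8"] by (simp add: K_def)
    qed
  qed
  finally have Q: "64 * card Q \<le> \<theta> * u" "8 * card Q \<le> u"
    using t(2,3) by (simp_all add: u_def flip: of_nat_le_iff[where 'a = real])
  have cardUX: "card (U - X) = u - card X" "card X \<le> u"
    using X finU fins by (simp_all add: card_Diff_subset u_def card_mono)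
  \<comment> \<open>At least a quarter of \<open>U\<close> lies outside \<open>X\<close>, so at
    least \<open>\<theta> * D * card X / 4\<close> edges leave \<open>X\<close>. At most
    \<open>\<theta> * D * card X / 8\<close> of them go to \<open>R\<close>; the others end in
    \<open>Q\<close>, which is too small to take them unless \<open>X\<close> is far below its
    allowed size.\<close>
  have cX: "8 * card X \<le> u"
  proof -
    have "\<theta> * D * card X / 4 * u \<le> \<theta> * D * card X * card (U - X)"
    proof -
      have "real u / 4 \<le> card (U - X)" using X(3) cardUX by simp
      then have "\<theta> * D * card X * (real u / 4) \<le> \<theta> * D * card X * card (U - X)"
        using pos by (intro mult_left_mono) auto
      then show ?thesis by simp
    qed
    then have "\<theta> * D * card X / 4 \<le> \<theta> * D * card X * card (U - X) / u"
      using u by (simp add: field_simps)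
    also have "\<dots> \<le> cut_size E X (U - X)" using cut[OF X(1)] by (simp add: u_def)
    also have "U - X = R \<union> Q" using QU X by (auto simp: R_def Q_def)
    also have "cut_size E X (R \<union> Q) = cut_size E X R + cut_size E Q X"
      using fins by (subst cut_size_Un_right) (auto simp: R_def cut_size_commute)
    also have "cut_size E X R \<le> \<theta> * D / 8 * card X" using cutX by (simp add: R_def Q_def)
    also have "cut_size E Q X \<le> D * card Q"
      using QU X(1) finU deg
      by (intro cut_size_le_degree order_trans[OF sum_mono2 deg]) auto
    also have "D * card Q \<le> D * (\<theta> * u / 64)" using Q(1) pos by (intro mult_left_mono) auto
    finally have "(\<theta> * D / 64) * (8 * real (card X)) \<le> (\<theta> * D / 64) * u" by (simp add: field_simps)
    moreover have "0 < \<theta> * D / 64" using pos by simp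
    ultimately have "8 * real (card X) \<le> u" by (metis mult_le_cancel_left_pos)
    then show ?thesis by linarith
  qed
  have cardR: "card R + card X + card Q = u"
  proof -
    have "card R = card (U - X) - card Q"
      unfolding R_def using QU X fins by (intro card_Diff_subset) (auto simp: Q_def)
    moreover have "card Q \<le> card (U - X)"
      using QU X finU by (intro card_mono) (auto simp: Q_def)
    ultimately show ?thesis using cardUX by simp
  qed
  have R_big: "3 * u \<le> 4 * card R" using cardR cX Q(2) by linarith
  have exp: "expander R E D (\<theta> / 8)"
  proof
    show "R \<noteq> {}" using R_big u by auto
    show "(\<Sum>y\<in>R. adj E x y) \<le> D" if "x \<in> R" for x
      using that finU by (intro order_trans[OF sum_mono2 deg]) (auto simp: R_def)
    fix W assume W: "W \<subseteq> R" "2 * card W \<le> card R"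
    show "\<theta> / 8 * D * card W \<le> cut_size E W (R - W)"
    proof (rule ccontr)
      assume "\<not> ?thesis"
      then have less: "cut_size E W (R - W) < \<theta> * D / 8 * card W" by (simp add: field_simps)
      have fW: "finite W" using W fins finite_subset by blast
      have W0: "0 < card W" using less cut_size_nonneg[of E W "R - W"] by (cases "card W = 0") auto
      have dis: "X \<inter> W = {}" using W by (auto simp: R_def)
      have c: "card (X \<union> W) = card X + card W" using fW fins dis by (simp add: card_Un_disjoint)
      have "cut_size E (X \<union> W) (R - W) = cut_size E X (R - W) + cut_size E W (R - W)"
        by (rule cut_size_Un_left[OF fins(1) fW dis])
      also have "cut_size E X (R - W) \<le> cut_size E X R" by (rule cut_size_mono) (use fins in auto)
      also have "\<dots> \<le> \<theta> * D / 8 * card X" using cutX by (simp add: R_def Q_def)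
      finally have "cut_size E (X \<union> W) (R - W) \<le> \<theta> * D / 8 * card (X \<union> W)"
        using less c by (simp add: algebra_simps)
      moreover have "U - (X \<union> W) - \<Union>\<B> = R - W" by (auto simp: R_def Q_def)
      \<comment> \<open>The slack between the allowed three quarters and the proved eighth makes
        room for \<open>W\<close>, which is at most half of \<open>R\<close>.\<close>
      moreover have "4 * card (X \<union> W) \<le> 3 * u" using c W(2) cX cardR by linarith
      ultimately have "valid (X \<union> W, \<B>)"
        using \<B> X W by (auto simp: valid_def R_def Q_def)
      from max[OF this] show False using c W0 by (simp add: \<mu>_def add_mult_distrib)
    qed
  qed (use fins pos in auto)
  interpret expander R E D "\<theta> / 8" by (rule exp)
  have "card \<B> = t"
  proof (rule ccontr)
    assume "card \<B> \<noteq> t"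
    then have lt: "card \<B> < t" using \<B> by (simp add: fam_def)
    define N where "N B = {y \<in> R. \<exists>x\<in>B. {x, y} \<in> E}" for B
    have NB: "\<theta> / 8 * r \<le> card (N B)" if B: "B \<in> \<B>" for B
    proof (rule ccontr)
      assume "\<not> ?thesis"
      then have small: "card (N B) < \<theta> / 8 * r" by simp
      have BU: "B \<subseteq> U" "B \<subseteq> Q" "r \<le> card B" using \<B> B by (auto simp: fam_def Q_def)
      have fB: "finite B" by (rule finite_subset[OF BU(1) finU])
      have dis: "X \<inter> B = {}" using X B by (auto simp: Q_def)
      have c: "card (X \<union> B) = card X + card B" using fB fins dis by (simp add: card_Un_disjoint)
      have "cut_size E B R \<le> D * card (N B)"
        unfolding N_def using BU finU fins fB
        by (intro cut_size_le_card_neighbours order_trans[OF sum_mono2 deg]) (auto simp: R_def)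
      also have "\<dots> \<le> D * (\<theta> / 8 * card B)"
        using small BU(3) pos
        by (intro mult_left_mono order_trans[OF less_imp_le[OF small]]) auto
      finally have "cut_size E (X \<union> B) R \<le> \<theta> * D / 8 * card (X \<union> B)"
        using cutX cut_size_Un_left[OF fins(1) fB dis, of E R] c
        by (simp add: algebra_simps R_def Q_def)
      \<comment> \<open>\<open>B\<close> passes from the minor to the trash and \<open>R\<close>
        stays the same, so only the edges from \<open>B\<close> to \<open>R\<close> are added to the
        cut.\<close>
      moreover have "U - (X \<union> B) - \<Union>(\<B> - {B}) = R" using B by (auto simp: R_def Q_def)
      moreover have "card B \<le> card Q" using BU fins by (intro card_mono) auto
      then have "4 * card (X \<union> B) \<le> 3 * u" using c cX Q(2) by linarith
      moreover have "fam (\<B> - {B})" using \<B> card_Diff1_le[of \<B> B]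
        by (auto simp: fam_def pairwise_def disjnt_def)
      moreover have "B \<inter> C = {}" if "C \<in> \<B> - {B}" for C
        using disjointD[of \<B> B C] \<B> B that by (simp add: fam_def) blast
      then have "(X \<union> B) \<inter> \<Union>(\<B> - {B}) = {}" using X(2) by blast
      ultimately have "valid (X \<union> B, \<B> - {B})" using X BU by (simp add: valid_def)
      from max[OF this] have "card X * (t + 1) + card B * (t + 1) + (card \<B> - 1) \<le> card X * (t + 1) + card \<B>"
        using c B fins by (simp add: \<mu>_def add_mult_distrib)
      then have "card B * (t + 1) + (card \<B> - 1) \<le> card \<B>" by (metis add.assoc nat_add_left_cancel_le)
      moreover have "1 * (t + 1) \<le> card B * (t + 1)" using BU(3) r(1) by (intro mult_right_mono) auto
      ultimately have "(t + 1) + (card \<B> - 1) \<le> card \<B>" unfolding mult_1 by (metis add_le_mono1 order_trans)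
      then show False using lt by linarith
    qed
    have "\<exists>W \<subseteq> R. spans_connected E W \<and> (\<forall>B\<in>\<B>. W \<inter> N B \<noteq> {}) \<and> card W \<le> real r + 1 + path_cost (\<theta> / 8) * card \<B>"
      by (rule ex_connected_meeting) (use fins NB r cardR in \<open>auto simp: N_def u_def\<close>)
    then obtain W where W: "W \<subseteq> R" "spans_connected E W" "\<forall>B\<in>\<B>. W \<inter> N B \<noteq> {}"
      "card W \<le> real r + 1 + path_cost (\<theta> / 8) * card \<B>" by blast
    note pc = path_cost_nonneg[of "\<theta> / 8"]
    have "path_cost (\<theta> / 8) * card \<B> \<le> path_cost (\<theta> / 8) * r" using lt t(1) pc by (intro mult_left_mono) auto
    then have WK: "card W \<le> K * r" using W(4) r(1) by (simp add: K_def algebra_simps)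
    have rR: "r \<le> card R" using r(3) R_big by (simp add: u_def)
    have rK: "r \<le> K * r" using pc by (simp add: K_def algebra_simps)
    obtain V where V: "V \<subseteq> R" "spans_connected E V" "W \<subseteq> V" "r \<le> card V" "card V \<le> K * r"
    proof (cases "r \<le> card W")
      case True
      then show ?thesis using that W WK by blast
    next
      case False
      then obtain V where "V \<subseteq> R" "W \<subseteq> V" "spans_connected E V" "card V = r"
        using extend_connected[OF W(1,2) _ rR] by auto
      then show ?thesis using that rK by simp
    qed
    have "V \<noteq> {}" using V(2) by (simp add: spans_connected_def)
    have VQ: "V \<inter> Q = {}" using V(1) by (auto simp: R_def)
    then have notin: "V \<notin> \<B>" using \<open>V \<noteq> {}\<close> by (auto simp: Q_def)
    have edge: "\<exists>x\<in>B. \<exists>y\<in>V. {x, y} \<in> E" if "B \<in> \<B>" for B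
    proof -
      have "W \<inter> N B \<noteq> {}" using bspec[OF W(3) that] .
      then obtain y where "y \<in> W" "y \<in> N B" by blast
      then obtain x where "y \<in> V" "x \<in> B" "{x, y} \<in> E" using subsetD[OF V(3)] by (auto simp: N_def)
      then show ?thesis by (intro bexI)
    qed
    then have edge': "\<exists>x\<in>V. \<exists>y\<in>B. {x, y} \<in> E" if "B \<in> \<B>" for B
      using edge[OF that] by (metis insert_commute)
    have "fam (insert V \<B>)"
      unfolding fam_def
    proof (intro conjI ballI impI)
      show "card (insert V \<B>) \<le> t" using lt fins notin by simp
      show "disjoint (insert V \<B>)"
        using \<B> VQ by (auto simp: fam_def pairwise_insert disjnt_def Q_def)
      fix B C assume "B \<in> insert V \<B>" "C \<in> insert V \<B>" "B \<noteq> C"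
      then show "\<exists>x\<in>B. \<exists>y\<in>C. {x, y} \<in> E"
        using edge edge' \<B> unfolding fam_def by (metis insertE)
    qed (use \<B> V in \<open>auto simp: fam_def R_def\<close>)
    moreover have "cut_size E X (U - X - \<Union>(insert V \<B>)) \<le> \<theta> * D / 8 * card X"
      by (rule order_trans[OF cut_size_mono cutX]) (use fins finU in auto)
    moreover have "X \<inter> \<Union>(insert V \<B>) = {}" using X V(1) by (auto simp: R_def)
    ultimately have "valid (X, insert V \<B>)" using X by (simp add: valid_def)
    from max[OF this] show False using notin fins by (simp add: \<mu>_def)
  qed
  then show ?thesis using \<B> unfolding fam_def by (intro exI[of _ \<B>]) blast
qed

section \<open>Expanding subsets of locally sparse graphs\<close>

lemma card_edges_le_parts:
  assumes "finite U" "W \<subseteq> U" "E \<subseteq> complete_edges V"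
  shows "card {e \<in> E. e \<subseteq> U} \<le> card {e \<in> E. e \<subseteq> W} + card {e \<in> E. e \<subseteq> U - W} + cut_size E W (U - W)"
proof -
  let ?P = "{p \<in> W \<times> (U - W). {fst p, snd p} \<in> E}"
  have fin: "finite {e \<in> E. e \<subseteq> W'}" if "W' \<subseteq> U" for W'
    by (rule finite_subset[of _ "Pow U"]) (use assms(1) that in auto)
  have finP: "finite ?P" using assms finite_subset[of W U] by auto
  have "{e \<in> E. e \<subseteq> U} \<subseteq> {e \<in> E. e \<subseteq> W} \<union> {e \<in> E. e \<subseteq> U - W} \<union> (\<lambda>p. {fst p, snd p}) ` ?P"
  proof
    fix e assume e: "e \<in> {e \<in> E. e \<subseteq> U}"
    then have "card e = 2" using assms(3) by (auto simp: complete_edges_def)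
    then obtain x y where xy: "e = {x, y}" by (auto simp: card_2_iff)
    show "e \<in> {e \<in> E. e \<subseteq> W} \<union> {e \<in> E. e \<subseteq> U - W} \<union> (\<lambda>p. {fst p, snd p}) ` ?P"
    proof (cases "x \<in> W \<longleftrightarrow> y \<in> W")
      case True
      then show ?thesis using e xy by auto
    next
      case False
      then have "(x, y) \<in> ?P \<or> (y, x) \<in> ?P" using e xy by (auto simp: insert_commute)
      moreover have "e = {fst (x, y), snd (x, y)}" "e = {fst (y, x), snd (y, x)}"
        using xy by auto
      ultimately have "e \<in> (\<lambda>p. {fst p, snd p}) ` ?P" by (metis (no_types, lifting) image_eqI)
      then show ?thesis by (rule UnI2)
    qed
  qed
  then have "card {e \<in> E. e \<subseteq> U} \<le> card ({e \<in> E. e \<subseteq> W} \<union> {e \<in> E. e \<subseteq> U - W} \<union> (\<lambda>p. {fst p, snd p}) ` ?P)"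
    using finP assms(2) by (intro card_mono finite_UnI finite_imageI fin) auto
  also have "\<dots> \<le> card {e \<in> E. e \<subseteq> W} + card {e \<in> E. e \<subseteq> U - W} + card ((\<lambda>p. {fst p, snd p}) ` ?P)"
    by (intro order_trans[OF card_Un_le] add_mono card_Un_le order_refl)
  also have "card ((\<lambda>p. {fst p, snd p}) ` ?P) \<le> card ?P" using finP by (rule card_image_le)
  finally have "card {e \<in> E. e \<subseteq> U} \<le> card {e \<in> E. e \<subseteq> W} + card {e \<in> E. e \<subseteq> U - W} + card ?P" by simp
  moreover have "real (card ?P) = cut_size E W (U - W)"
  proof -
    have "cut_size E W (U - W) = (\<Sum>p\<in>W \<times> (U - W). of_bool ({fst p, snd p} \<in> E))"
      by (simp add: cut_size_def adj_def sum.cartesian_product case_prod_beta)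
    also have "\<dots> = card ?P" using assms finite_subset[of W U] by (simp add: Int_def)
    finally show ?thesis by simp
  qed
  ultimately show ?thesis by linarith
qed

text \<open>A minimal set \<open>U\<close> spanning at least \<open>c |U| + \<delta> |U|\<^sup>2 / |V|\<close> edges: the convexity of this bound
  forces many edges across each cut of \<open>U\<close>.\<close>

lemma ex_expanding_subset:
  fixes \<alpha> c \<delta> :: real
  assumes fin: "finite V" "V \<noteq> {}" and E: "E \<subseteq> complete_edges V"
    and total: "(c + \<delta>) * card V \<le> card E" and \<delta>: "0 < \<delta>"
    and sparse: "\<And>W. W \<subseteq> V \<Longrightarrow> W \<noteq> {} \<Longrightarrow> card W \<le> \<alpha> * card V \<Longrightarrow> card {e \<in> E. e \<subseteq> W} < c * card W"
  shows "\<exists>U \<subseteq> V. \<alpha> * card V < card U \<and> 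
     (\<forall>W \<subseteq> U. 2 * \<delta> * card W * card (U - W) / card V \<le> cut_size E W (U - W))"
proof -
  define n where "n = real (card V)"
  have n: "0 < n" using fin by (simp add: n_def card_gt_0_iff)
  define g where "g x = c * x + \<delta> * x\<^sup>2 / n" for x
  define P where "P U \<longleftrightarrow> U \<subseteq> V \<and> U \<noteq> {} \<and> g (card U) \<le> card {e \<in> E. e \<subseteq> U}" for U
  have "{e \<in> E. e \<subseteq> V} = E" using E by (auto simp: complete_edges_def)
  then have "P V" using total n fin by (simp add: P_def g_def n_def[symmetric] power2_eq_square algebra_simps)
  then obtain U where U: "P U" and min: "\<And>U'. P U' \<Longrightarrow> card U \<le> card U'"
    using ex_has_least_nat[of P V card] by blast
  have fU: "finite U" using U fin finite_subset by (auto simp: P_def)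
  have "\<alpha> * card V < card U"
  proof (rule ccontr)
    assume "\<not> ?thesis"
    then have "card {e \<in> E. e \<subseteq> U} < c * card U" using U by (intro sparse) (auto simp: P_def)
    moreover have "c * card U \<le> g (card U)" using \<delta> n by (simp add: g_def)
    ultimately show False using U by (simp add: P_def)
  qed
  moreover have "2 * \<delta> * card W * card (U - W) / card V \<le> cut_size E W (U - W)" if W: "W \<subseteq> U" for W
  proof (cases "W = {} \<or> W = U")
    case True
    then show ?thesis using cut_size_nonneg[of E W "U - W"] by auto
  next
    case False
    have fW: "finite W" using W fU finite_subset by blast
    have c: "card U = card W + card (U - W)" using W fU fW by (simp add: card_Diff_subset card_mono)
    have "card W \<noteq> 0" "card (U - W) \<noteq> 0" using False W fU fW by auto
    then have "\<not> P W" "\<not> P (U - W)" using min[of W] min[of "U - W"] c by auto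
    then have "card {e \<in> E. e \<subseteq> W} < g (card W)" "card {e \<in> E. e \<subseteq> U - W} < g (card (U - W))"
      using False W U by (auto simp: P_def)
    moreover have "g (card U) \<le> card {e \<in> E. e \<subseteq> U}" using U by (simp add: P_def)
    moreover have "real (card {e \<in> E. e \<subseteq> U})
        \<le> card {e \<in> E. e \<subseteq> W} + card {e \<in> E. e \<subseteq> U - W} + cut_size E W (U - W)"
      by (rule card_edges_le_parts[OF fU W E])
    \<comment> \<open>Only the square in \<open>g\<close> fails to be additive. Its cross term is
      the surplus that the edges of the cut must supply.\<close>
    moreover have "g (card U) = g (card W) + g (card (U - W)) + 2 * \<delta> * card W * card (U - W) / n"
      using n unfolding c g_def by (simp add: field_simps power2_eq_square)
    ultimately show ?thesis unfolding n_def by linarith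
  qed
  ultimately show ?thesis using U unfolding P_def by blast
qed

section \<open>Complete minors of square root order\<close>

lemma has_minor_complete_graph:
  fixes E :: "'a set set"
  assumes "finite \<B>" "card \<B> = t" "disjoint \<B>"
    and "\<And>B. B \<in> \<B> \<Longrightarrow> B \<subseteq> V \<and> spans_connected E B"
    and "\<And>B C. B \<in> \<B> \<Longrightarrow> C \<in> \<B> \<Longrightarrow> B \<noteq> C \<Longrightarrow> \<exists>x\<in>B. \<exists>y\<in>C. {x, y} \<in> E"
  shows "has_minor (V, E) (complete_graph {..<t})"
proof -
  obtain f where f: "bij_betw f {..<t} \<B>"
    using ex_bij_betw_nat_finite[OF assms(1)] assms(2) by (auto simp: atLeast0LessThan)
  have mem: "f i \<in> \<B>" if "i < t" for i using f that by (auto simp: bij_betw_def)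
  have inj: "f i \<noteq> f k" if "i < t" "k < t" "i \<noteq> k" for i k
    using f that by (auto simp: bij_betw_def inj_on_def)
  have "disjoint_family_on f {..<t}"
    unfolding disjoint_family_on_def using disjointD[OF assms(3)] mem inj by simp
  moreover have "\<exists>x\<in>f i. \<exists>y\<in>f k. {x, y} \<in> E"
    if "i < t" "k < t" "{i, k} \<in> complete_edges {..<t}" for i k
  proof -
    have "i \<noteq> k" using that(3) by (auto simp: complete_edges_def)
    then show ?thesis using assms(5) mem inj that by simp
  qed
  ultimately show ?thesis
    unfolding has_minor_def complete_graph_def using mem assms(4) by (intro exI[of _ f]) simp
qed

lemma ex_sqrt_minor:
  fixes \<theta> :: real
  assumes \<theta>: "0 < \<theta>"
  shows "\<exists>c > 0. \<forall>(U :: 'a set) E D t. 16 \<le> card U \<longrightarrow> 0 < D \<longrightarrow>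
     (\<forall>x\<in>U. (\<Sum>y\<in>U. adj E x y) \<le> D) \<longrightarrow>
     (\<forall>W\<subseteq>U. \<theta> * D * card W * card (U - W) / card U \<le> cut_size E W (U - W)) \<longrightarrow>
     t \<le> c * sqrt (card U) \<longrightarrow>
     has_minor (U, E) (complete_graph {..<t :: nat})"
proof -
  define K where "K = 2 + path_cost (\<theta> / 8)"
  have K: "2 \<le> K" using path_cost_nonneg by (simp add: K_def)
  \<comment> \<open>For \<open>q = sqrt (card U)\<close> the bounds \<open>t \<le> c * q\<close> and
    \<open>r \<le> 2 * q\<close> give \<open>t * (K * r) \<le> 2 * c * K * card U\<close>, which has
    to be at most \<open>\<theta> / 64\<close> and \<open>1 / 8\<close> times
    \<open>card U\<close>.\<close>
  define c where "c = min (\<theta> / 128) (1 / 16) / K"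
  have c0: "0 < c" using \<theta> K by (simp add: c_def)
  have c: "c * K \<le> \<theta> / 128" "c * K \<le> 1 / 16" using K by (auto simp: c_def)
  have "c * 2 \<le> c * K" using K c0 by (intro mult_left_mono) auto
  then have c1: "c \<le> 1" using c(2) by linarith
  have "has_minor (U, E) (complete_graph {..<t})"
    if u: "16 \<le> card U" and D: "0 < D" and deg: "\<forall>x\<in>U. (\<Sum>y\<in>U. adj E x y) \<le> D"
      and cut: "\<forall>W\<subseteq>U. \<theta> * D * card W * card (U - W) / card U \<le> cut_size E W (U - W)"
      and t: "t \<le> c * sqrt (card U)" for U :: "'a set" and E D and t :: nat
  proof -
    define q where "q = sqrt (card U)"
    define r where "r = nat \<lceil>q\<rceil>"
    have qq: "q * q = card U" by (simp add: q_def)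
    have "sqrt (4 * 4) \<le> q" unfolding q_def using u by (subst real_sqrt_le_iff) simp
    then have q4: "4 \<le> q" by simp
    have r: "q \<le> r" "r \<le> q + 1" unfolding r_def using q4 by linarith+
    have fin: "finite U" using u by (metis card.infinite not_numeral_le_zero)
    have tq: "t \<le> c * q" using t by (simp add: q_def)
    have r2: "r \<le> 2 * q" using r q4 by linarith
    have tKr: "t * (K * r) \<le> c * q * (K * (2 * q))"
      using tq r2 K c0 q4 by (intro mult_mono mult_left_mono) auto
    also have "\<dots> = 2 * (c * K) * card U" by (simp add: qq[symmetric])
    finally have tKr: "t * (K * r) \<le> 2 * (c * K) * card U" .
    have "\<exists>\<B>. finite \<B> \<and> card \<B> = t \<and> disjoint \<B> \<and> (\<forall>B\<in>\<B>. B \<subseteq> U \<and> spans_connected E B) \<and>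
       (\<forall>B\<in>\<B>. \<forall>C\<in>\<B>. B \<noteq> C \<longrightarrow> (\<exists>x\<in>B. \<exists>y\<in>C. {x, y} \<in> E))"
    proof (rule ex_clique_minor[of U D \<theta> E r t, OF fin D \<theta>])
      show "1 \<le> r" using r q4 by linarith
      have "q * q \<le> real r * real r" using r q4 by (intro mult_mono) auto
      then have "real (card U) \<le> real (r\<^sup>2)" by (simp add: qq power2_eq_square)
      then show "card U \<le> r\<^sup>2" by (simp only: of_nat_le_iff)
      have "4 * q \<le> q * q" using q4 by (intro mult_right_mono) auto
      then have "4 * real r \<le> 3 * real (card U)" using r q4 qq by linarith
      then show "4 * r \<le> 3 * card U" by linarith
      have "c * q \<le> 1 * q" using c1 q4 by (intro mult_right_mono) auto
      then have "real t \<le> real r" using tq r by linarith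
      then show "t \<le> r" by simp
      have "2 * (c * K) * card U \<le> 2 * (\<theta> / 128) * card U"
        using c by (intro mult_right_mono mult_left_mono) auto
      then show "64 * (real t * ((2 + path_cost (\<theta> / 8)) * real r)) \<le> \<theta> * real (card U)"
        using tKr by (simp add: K_def)
      have "2 * (c * K) * card U \<le> 2 * (1 / 16) * card U"
        using c by (intro mult_right_mono mult_left_mono) auto
      then show "8 * (real t * ((2 + path_cost (\<theta> / 8)) * real r)) \<le> real (card U)"
        using tKr by (simp add: K_def)
    qed (use deg cut in auto)
    then obtain \<B> where \<B>: "finite \<B>" "card \<B> = t" "disjoint \<B>"
      "\<forall>B\<in>\<B>. B \<subseteq> U \<and> spans_connected E B"
      "\<forall>B\<in>\<B>. \<forall>C\<in>\<B>. B \<noteq> C \<longrightarrow> (\<exists>x\<in>B. \<exists>y\<in>C. {x, y} \<in> E)" by (elim exE conjE)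
    show ?thesis
      by (rule has_minor_complete_graph[OF \<B>(1-3) \<B>(4)[rule_format] \<B>(5)[rule_format]])
  qed
  then show ?thesis using c0 by blast
qed

lemma has_minor_mono:
  assumes "has_minor (U, E') H" "U \<subseteq> V" "E' \<subseteq> E"
  shows "has_minor (V, E) H"
proof -
  obtain B where B: "disjoint_family_on B (fst H)"
    "\<forall>u\<in>fst H. B u \<subseteq> U \<and> spans_connected E' (B u)"
    "\<forall>u\<in>fst H. \<forall>v\<in>fst H. {u, v} \<in> snd H \<longrightarrow> (\<exists>x\<in>B u. \<exists>y\<in>B v. {x, y} \<in> E')"
    using assms(1) unfolding has_minor_def fst_conv snd_conv by (elim exE conjE)
  have "B u \<subseteq> V \<and> spans_connected E (B u)" if "u \<in> fst H" for u
    using B(2) that assms(2) spans_connected_mono[OF _ assms(3)] by (meson order_trans)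
  moreover have "\<exists>x\<in>B u. \<exists>y\<in>B v. {x, y} \<in> E"
    if "u \<in> fst H" "v \<in> fst H" "{u, v} \<in> snd H" for u v
    using B(3)[rule_format, OF that] assms(3) by (meson subsetD)
  ultimately show ?thesis
    unfolding has_minor_def fst_conv snd_conv using B(1) by (intro exI[of _ B]) simp
qed

section \<open>Sparseness of the graph of Avoider\<close>

text \<open>Divided by \<open>fact k\<close>, the left side is a single term of the series of
  \<open>exp k\<close>.\<close>

lemma power_le_fact: "real k ^ k \<le> 3 ^ k * fact k"
proof -
  have "(\<Sum>i\<in>{k}. real k ^ i /\<^sub>R fact i) \<le> exp (real k)"
    unfolding exp_def by (rule sum_le_suminf[OF summable_exp_generic]) auto
  then have "real k ^ k \<le> exp (real k) * fact k"
    by (simp add: field_simps)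
  also have "exp (real k) = exp 1 ^ k" using exp_of_nat_mult[of k "1::real"] by simp
  also have "exp 1 ^ k * fact k \<le> 3 ^ k * (fact k :: real)"
    by (intro mult_right_mono power_mono) (use exp_le in auto)
  finally show ?thesis .
qed

lemma choose_le_power: "real (N choose k) \<le> (3 * real N / real k) ^ k"
proof (cases "k = 0")
  case False
  have "real (N choose k) * real k ^ k \<le> real (N choose k) * (3 ^ k * fact k)"
    using power_le_fact by (intro mult_left_mono) auto
  also have "\<dots> = 3 ^ k * real ((N choose k) * fact k)" by simp
  also have "\<dots> \<le> 3 ^ k * real (N ^ k)"
    using binomial_fact_pow[of N k] by (intro mult_left_mono) (simp_all only: of_nat_le_iff, simp)
  finally show ?thesis using False by (simp add: power_mult_distrib power_divide field_simps)
qed simp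

text \<open>At a vertex of degree \<open>d > k\<close> there are at least as many stars with
  \<open>k\<close> edges as edges, so counting stars bounds the edges at vertices of high degree.
  For \<open>d = k\<close> there is only one star.\<close>

lemma le_choose: "1 \<le> k \<Longrightarrow> k < d \<Longrightarrow> d \<le> d choose k"
proof (induction d)
  case (Suc d)
  obtain l where k: "k = Suc l" using Suc.prems(1) by (cases k) auto
  show ?case
  proof (cases "k = d")
    case False
    then have "d \<le> d choose k" using Suc by simp
    moreover have "0 < d choose l" using Suc.prems k by (intro zero_less_binomial) simp
    moreover have "Suc d choose k = (d choose l) + (d choose k)" by (simp add: k)
    ultimately show ?thesis by linarith
  qed (use binomial_Suc_n[of d] in simp)
qed simp

lemma card_complete_edges: "finite V \<Longrightarrow> card (complete_edges V) = card V choose 2"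
  by (simp add: complete_edges_def n_subsets)

lemma finite_complete_edges: "finite V \<Longrightarrow> finite (complete_edges V)"
  by (simp add: complete_edges_def)

text \<open>With \<open>z = 12 * w / n\<close> the two binomial factors are at most \<open>(36 / z) ^ w\<close> and
  \<open>z powr ((1 + \<xi>) * w)\<close>; the bound on \<open>w\<close> says that \<open>z powr \<xi> \<le> 1/144\<close>.\<close>

lemma dense_set_weight_le:
  fixes n w j :: nat and k \<xi> B :: real
  assumes w: "1 \<le> w" "12 * w \<le> ((1/144) powr (1/\<xi>)) * n" and \<xi>: "0 < \<xi>" and k: "1 + \<xi> \<le> k"
    and j: "k * w \<le> j" and B: "0 < B" "n \<le> 8 * k * B"
  shows "real (n choose w) * (real ((w choose 2) choose j) / B ^ j) \<le> (1/4) ^ w"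
proof -
  define z where "z = 12 * w / n"
  have n: "0 < n"
  proof (rule ccontr)
    assume "\<not> 0 < n"
    then show False using w by simp
  qed
  have z0: "0 < z" using n w by (simp add: z_def)
  have z: "z \<le> (1/144) powr (1/\<xi>)" using w n by (simp add: z_def field_simps)
  have "(1/144) powr (1/\<xi>) \<le> (1::real) powr (1/\<xi>)" using \<xi> by (intro powr_mono2) auto
  then have z1: "z \<le> 1" using z by simp
  have "z powr \<xi> \<le> ((1/144) powr (1/\<xi>)) powr \<xi>" using z z0 \<xi> by (intro powr_mono2) auto
  then have z\<xi>: "z powr \<xi> \<le> 1/144" using \<xi> by (simp add: powr_powr)
  have kw: "0 < k * w" using k \<xi> w by simp
  then have j0: "0 < real j" using j by linarith
  have k0: "0 < k" using k \<xi> by simp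
  have "real ((w choose 2) choose j) \<le> (3 * real (w choose 2) / j) ^ j" by (rule choose_le_power)
  also have "\<dots> \<le> (3 * (w * w / 2) / (k * w)) ^ j"
  proof (intro power_mono frac_le mult_left_mono)
    have "w choose 2 \<le> w * w div 2" by (simp add: choose_two div_le_mono)
    then have "2 * (w choose 2) \<le> w * w" by simp
    then show "real (w choose 2) \<le> real (w * w) / 2" by linarith
  qed (use kw j in auto)
  also have "3 * (w * w / 2) / (k * w) = 3 * w / (2 * k)" using w k0 by (simp add: field_simps)
  finally have "real ((w choose 2) choose j) / B ^ j \<le> (3 * w / (2 * k)) ^ j / B ^ j"
    using B by (intro divide_right_mono) auto
  \<comment> \<open>This is where the 12 in \<open>z\<close> comes from:
    \<open>n \<le> 8 * k * B\<close> brings the base down to \<open>12 * w / n\<close>.\<close>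
  also have "\<dots> = (12 * w / (8 * k * B)) ^ j" by (simp add: power_divide[symmetric] ac_simps)
  also have "\<dots> \<le> z ^ j"
    unfolding z_def using B n k0 by (intro power_mono divide_left_mono) auto
  also have "\<dots> = z powr j" using z0 by (simp add: powr_realpow)
  also have "\<dots> \<le> z powr ((1 + \<xi>) * w)"
  proof (rule powr_mono')
    have "(1 + \<xi>) * w \<le> k * w" using k by (intro mult_right_mono) auto
    then show "(1 + \<xi>) * w \<le> j" using j by linarith
  qed (use z0 z1 in auto)
  also have "\<dots> = z ^ w * (z powr \<xi>) ^ w"
    using z0 by (simp add: powr_realpow[symmetric] powr_powr powr_add[symmetric] algebra_simps)
  also have "\<dots> \<le> z ^ w * (1/144) ^ w" using z\<xi> z0 by (intro mult_left_mono power_mono) auto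
  finally have 1: "real ((w choose 2) choose j) / B ^ j \<le> z ^ w * (1/144) ^ w" .
  have "real (n choose w) * (real ((w choose 2) choose j) / B ^ j)
      \<le> (3 * n / w) ^ w * (z ^ w * (1/144) ^ w)"
    using choose_le_power[of n w] 1 B by (intro mult_mono) auto
  also have "\<dots> = (3 * n / w * z * (1/144)) ^ w" by (simp only: power_mult_distrib mult.assoc)
  also have "3 * n / w * z * (1/144) = 1/4" using n w by (simp add: z_def)
  finally show ?thesis .
qed

text \<open>By \<open>K * c \<le> d\<close> and \<open>n \<le> 4 * c * B\<close>, the base
  \<open>3 * n / (d * B)\<close> is at most \<open>12 / K\<close>, which is at most 1; a single
  power of it suffices.\<close>

lemma star_weight_le:
  fixes n d :: nat and c B K :: real
  assumes "1 \<le> d" "K * c \<le> d" "0 < c" "12 \<le> K" "0 < B" "n \<le> 4 * c * B"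
  shows "real (n choose d) / B ^ d \<le> 12 / K"
proof -
  have "real (n choose d) / B ^ d \<le> (3 * n / d) ^ d / B ^ d"
    using choose_le_power[of n d] assms by (intro divide_right_mono) auto
  also have "\<dots> = (3 * n / (d * B)) ^ d" by (simp add: power_divide[symmetric])
  also have "\<dots> \<le> (12 / K) ^ d"
  proof (intro power_mono)
    have "3 * real n \<le> 3 * (4 * c * B)" using assms(6) by linarith
    then have "3 * real n * K \<le> 3 * (4 * c * B) * K" using assms(4) by (intro mult_right_mono) auto
    also have "\<dots> = 12 * (K * c) * B" by simp
    also have "\<dots> \<le> 12 * d * B" using assms by (intro mult_right_mono) auto
    finally show "real (3 * n) / (d * B) \<le> 12 / K" using assms by (simp add: field_simps)
  qed (use assms in auto)
  also have "\<dots> \<le> (12 / K) ^ 1" using assms by (intro power_decreasing) auto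
  finally show ?thesis by simp
qed

lemma sum_quarter_powers: "(\<Sum>w = 1..n. (1/4 :: real) ^ w) \<le> 1/3"
proof -
  have "(\<Sum>w = 1..n. a w) = (1 - a n) / 3" if "a 0 = 1" "\<And>i. a (Suc i) = a i / 4"
    for a :: "nat \<Rightarrow> real"
    using that(1) by (induction n) (simp_all add: that(2))
  from this[of "\<lambda>w. (1/4) ^ w"] show ?thesis by simp
qed

text \<open>The family consists of the edge sets \<open>F\<close> that make a small vertex set \<open>W\<close> too dense, with weight
  \<open>1\<close>, and of the stars with \<open>d\<close> edges, whose weight \<open>s\<close> makes them contribute at most \<open>1/3\<close>. As the total
  is less than \<open>1\<close>, no dense set survives, and the number of stars is \<open>O(1 / s)\<close>.\<close>

lemma enforcer_forces_sparse:
  fixes n b d :: nat and c k \<xi> K \<alpha> :: real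
  defines "V \<equiv> {..<n}"
  defines "\<alpha> \<equiv> ((1/144) powr (1/\<xi>)) / 12"
  assumes n: "1 \<le> n" and \<xi>: "0 < \<xi>" and k: "1 + \<xi> \<le> k" and c: "c \<le> 2 * k" "0 < c"
    and nB: "n \<le> 4 * c * (1 + real b)" and K: "12 \<le> K" and d: "K * c \<le> d"
  shows "enforcer_can_force (complete_edges V) b (\<lambda>A.
     (\<forall>W. W \<subseteq> V \<longrightarrow> W \<noteq> {} \<longrightarrow> card W \<le> \<alpha> * n \<longrightarrow> card {e \<in> A. e \<subseteq> W} < k * card W) \<and>
     (\<Sum>v\<in>V. real (card {e \<in> A. v \<in> e} choose d)) \<le> 24 * n / K)"
proof -
  define B where "B = 1 + real b"
  define j where "j W = nat \<lceil>k * card W\<rceil>" for W :: "nat set"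
  define \<W> where "\<W> = {W. W \<subseteq> V \<and> W \<noteq> {} \<and> card W \<le> \<alpha> * n}"
  define S1 where "S1 W = {F. F \<subseteq> complete_edges W \<and> card F = j W}" for W
  define S2 where "S2 v = {F. F \<subseteq> {e \<in> complete_edges V. v \<in> e} \<and> card F = d}" for v
  define I1 where "I1 = Sigma \<W> S1"
  define I2 where "I2 = Sigma V S2"
  \<comment> \<open>Chosen so that the \<open>n\<close> vertices together contribute at most
    \<open>n * s * (12 / K) = 1/3\<close>.\<close>
  define s where "s = K / (36 * n)"
  define F where "F = case_sum (snd :: nat set \<times> nat set set \<Rightarrow> nat set set) (snd :: nat \<times> nat set set \<Rightarrow> nat set set)"
  define wt where "wt = case_sum (\<lambda>_ :: nat set \<times> nat set set. 1) (\<lambda>_ :: nat \<times> nat set set. s)"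
  have B: "0 < B" by (simp add: B_def)
  have d1: "1 \<le> d"
  proof -
    have "0 < K * c" using K c by simp
    then show ?thesis using d by linarith
  qed
  have s0: "0 < s" using K n by (simp add: s_def)
  have finV: "finite V" by (simp add: V_def)
  have fW: "finite W" if "W \<in> \<W>" for W using that finV finite_subset by (auto simp: \<W>_def)
  have fS1: "finite (S1 W)" if "W \<in> \<W>" for W
    using finite_complete_edges[OF fW[OF that]] by (simp add: S1_def)
  have fS2: "finite (S2 v)" for v using finite_complete_edges[OF finV] by (simp add: S2_def)
  have fin\<W>: "finite \<W>" using finV by (simp add: \<W>_def)
  have fI: "finite I1" "finite I2"
    using fin\<W> fS1 fS2 finV by (auto simp: I1_def I2_def)
  interpret weighted_family "I1 <+> I2" F wt b
  proof
    show "finite (F i)" if "i \<in> I1 <+> I2" for i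
    proof (cases i)
      case (Inl p)
      then have "snd p \<subseteq> complete_edges (fst p)" "fst p \<in> \<W>"
        using that by (auto simp: I1_def S1_def)
      then show ?thesis using finite_subset finite_complete_edges[OF fW] Inl by (auto simp: F_def)
    next
      case (Inr p)
      then have "snd p \<subseteq> complete_edges V" using that by (auto simp: I2_def S2_def)
      then show ?thesis using finite_subset finite_complete_edges[OF finV] Inr by (auto simp: F_def)
    qed
    show "0 \<le> wt i" for i using s0 by (auto simp: wt_def split: sum.split)
  qed (use fI in simp)
  have sum1: "(\<Sum>i\<in>I1. 1 / B ^ card (snd i)) \<le> 1/3"
  proof -
    define f where "f W = real ((card W choose 2) choose j W) / B ^ j W" for W :: "nat set"
    have "(\<Sum>i\<in>I1. 1 / B ^ card (snd i)) = (\<Sum>W\<in>\<W>. \<Sum>F\<in>S1 W. 1 / B ^ card F)"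
      unfolding I1_def using fin\<W> fS1 by (subst sum.Sigma) (auto simp: case_prod_beta)
    also have "\<dots> = (\<Sum>W\<in>\<W>. f W)"
    proof (intro sum.cong refl)
      fix W assume W: "W \<in> \<W>"
      have "(\<Sum>F\<in>S1 W. 1 / B ^ card F) = (\<Sum>F\<in>S1 W. 1 / B ^ j W)"
        by (intro sum.cong) (auto simp: S1_def)
      also have "\<dots> = f W"
        using fW[OF W] by (simp add: f_def S1_def n_subsets finite_complete_edges card_complete_edges)
      finally show "(\<Sum>F\<in>S1 W. 1 / B ^ card F) = f W" .
    qed
    also have "\<dots> = (\<Sum>w = 1..n. \<Sum>W | W \<in> \<W> \<and> card W = w. f W)"
    proof (rule sum.group[symmetric])
      have "card W \<in> {1..n}" if "W \<in> \<W>" for W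
      proof -
        have "card W \<le> card V" using that finV by (intro card_mono) (auto simp: \<W>_def)
        moreover have "card W \<noteq> 0" using that fW[OF that] by (auto simp: \<W>_def)
        ultimately show ?thesis by (simp add: V_def)
      qed
      then show "card ` \<W> \<subseteq> {1..n}" by blast
    qed (use fin\<W> in auto)
    also have "\<dots> \<le> (\<Sum>w = 1..n. (1/4) ^ w)"
    proof (intro sum_mono)
      fix w assume w: "w \<in> {1..n}"
      define jw where "jw = nat \<lceil>k * w\<rceil>"
      show "(\<Sum>W | W \<in> \<W> \<and> card W = w. f W) \<le> (1/4) ^ w"
      proof (cases "w \<le> \<alpha> * n")
        case False
        then have "{W. W \<in> \<W> \<and> card W = w} = {}" by (auto simp: \<W>_def)
        then show ?thesis by (metis sum.empty zero_le_power zero_le_divide_1_iff zero_le_numeral)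
      next
        case True
        have "(\<Sum>W | W \<in> \<W> \<and> card W = w. f W)
            = (\<Sum>W | W \<in> \<W> \<and> card W = w. real ((w choose 2) choose jw) / B ^ jw)"
          by (intro sum.cong) (auto simp: f_def j_def jw_def)
        also have "\<dots> = card {W. W \<in> \<W> \<and> card W = w} * (real ((w choose 2) choose jw) / B ^ jw)"
          by simp
        also have "\<dots> \<le> (n choose w) * (real ((w choose 2) choose jw) / B ^ jw)"
        proof (intro mult_right_mono of_nat_mono)
          have "card {W. W \<in> \<W> \<and> card W = w} \<le> card {W. W \<subseteq> V \<and> card W = w}"
            using finV by (intro card_mono) (auto simp: \<W>_def)
          then show "card {W. W \<in> \<W> \<and> card W = w} \<le> n choose w"
            using finV by (simp add: n_subsets V_def)
        qed (use B in auto)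
        also have "\<dots> \<le> (1/4) ^ w"
        proof (rule dense_set_weight_le[OF _ _ \<xi> k _ B])
          show "1 \<le> w" using w by simp
          show "real (12 * w) \<le> (1/144) powr (1/\<xi>) * n" using True by (simp add: \<alpha>_def)
          show "k * w \<le> jw" by (simp add: jw_def real_nat_ceiling_ge)
          \<comment> \<open>As \<open>c\<close> is at most twice \<open>k\<close>, the bound on
            \<open>n\<close> in terms of \<open>c\<close> becomes one in terms of
            \<open>k\<close>.\<close>
          have "4 * c * B \<le> 4 * (2 * k) * B" using c B by (intro mult_right_mono mult_left_mono) auto
          then show "n \<le> 8 * k * B" using nB unfolding B_def by linarith
        qed
        finally show ?thesis .
      qed
    qed
    also have "\<dots> \<le> 1/3" by (rule sum_quarter_powers)
    finally show ?thesis .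
  qed
  have sum2: "(\<Sum>i\<in>I2. s / B ^ card (snd i)) \<le> 1/3"
  proof -
    have "(\<Sum>i\<in>I2. s / B ^ card (snd i)) = (\<Sum>v\<in>V. \<Sum>F\<in>S2 v. s / B ^ card F)"
      unfolding I2_def using finV fS2 by (subst sum.Sigma) (auto simp: case_prod_beta)
    also have "\<dots> \<le> (\<Sum>v\<in>V. s * (12 / K))"
    proof (intro sum_mono)
      fix v assume v: "v \<in> V"
      have "(\<Sum>F\<in>S2 v. s / B ^ card F) = (\<Sum>F\<in>S2 v. s / B ^ d)"
        by (intro sum.cong) (auto simp: S2_def)
      also have "\<dots> = s * (real (card (S2 v)) / B ^ d)" by simp
      also have "card (S2 v) \<le> n choose d"
      proof -
        have "{e \<in> complete_edges V. v \<in> e} \<subseteq> (\<lambda>u. {v, u}) ` V"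
          by (auto simp: complete_edges_def card_2_iff)
        then have "card {e \<in> complete_edges V. v \<in> e} \<le> card ((\<lambda>u. {v, u}) ` V)"
          using finV by (intro card_mono) auto
        also have "\<dots> \<le> n" using card_image_le[OF finV, of "\<lambda>u. {v, u}"] by (simp add: V_def)
        finally have "card {e \<in> complete_edges V. v \<in> e} choose d \<le> n choose d"
          by (rule binomial_right_mono)
        then show ?thesis using finV by (simp add: S2_def n_subsets finite_complete_edges)
      qed
      then have "s * (real (card (S2 v)) / B ^ d) \<le> s * (real (n choose d) / B ^ d)"
        using s0 B by (intro mult_left_mono divide_right_mono) auto
      also have "\<dots> \<le> s * (12 / K)"
        using s0 nB by (intro mult_left_mono star_weight_le[OF d1 d c(2) K B]) (auto simp: B_def)
      finally show "(\<Sum>F\<in>S2 v. s / B ^ card F) \<le> s * (12 / K)" .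
    qed
    also have "\<dots> = 1/3" using K n by (simp add: s_def V_def)
    finally show ?thesis .
  qed
  have total: "(\<Sum>i\<in>I1 <+> I2. wt i / (1 + real b) ^ card (F i)) \<le> 2/3"
    using sum1 sum2 fI by (simp add: sum.Plus wt_def F_def B_def o_def)
  show ?thesis
  proof (rule enforcer_can_force_mono[OF enforcer_can_force_weight[OF finite_complete_edges[OF finV]]])
    fix ms assume ms: "legal_play (complete_edges V) b ms"
    define A where "A = avoider_claims ms"
    have AX: "A \<subseteq> complete_edges V"
      using legal_play_claims[OF finite_complete_edges[OF finV] ms] by (simp add: A_def)
    have fA: "finite A" using AX finite_complete_edges[OF finV] finite_subset by blast
    assume "(\<Sum>i \<in> {i \<in> I1 <+> I2. F i \<subseteq> avoider_claims ms}. wt i) \<le> (\<Sum>i\<in>I1 <+> I2. wt i / (1 + real b) ^ card (F i))"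
    then have le: "(\<Sum>i \<in> {i \<in> I1 <+> I2. F i \<subseteq> A}. wt i) \<le> 2/3" using total by (simp add: A_def)
    have split: "{i \<in> I1 <+> I2. F i \<subseteq> A} = {i \<in> I1. snd i \<subseteq> A} <+> {i \<in> I2. snd i \<subseteq> A}"
      by (auto simp: F_def)
    have le': "real (card {i \<in> I1. snd i \<subseteq> A}) + s * card {i \<in> I2. snd i \<subseteq> A} \<le> 2/3"
      using le fI unfolding split by (simp add: sum.Plus wt_def o_def mult.commute)
    have "0 \<le> s * card {i \<in> I2. snd i \<subseteq> A}" using s0 by simp
    \<comment> \<open>A natural number that is at most 2/3 vanishes.\<close>
    then have "card {i \<in> I1. snd i \<subseteq> A} = 0" using le' by linarith
    then have empty: "{i \<in> I1. snd i \<subseteq> A} = {}" using fI by simp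
    have sparse: "card {e \<in> A. e \<subseteq> W} < k * card W" if "W \<subseteq> V" "W \<noteq> {}" "card W \<le> \<alpha> * n" for W
    proof (rule ccontr)
      assume "\<not> ?thesis"
      then have "j W \<le> card {e \<in> A. e \<subseteq> W}" by (simp add: j_def)
      then obtain F' where F': "F' \<subseteq> {e \<in> A. e \<subseteq> W}" "card F' = j W"
        by (rule obtain_subset_with_card_n)
      then have "(W, F') \<in> {i \<in> I1. snd i \<subseteq> A}"
        using that AX by (auto simp: I1_def \<W>_def S1_def complete_edges_def)
      then show False using empty by blast
    qed
    have "s * card {i \<in> I2. snd i \<subseteq> A} \<le> 2/3" using le' by linarith
    moreover have "real (card {i \<in> I2. snd i \<subseteq> A}) = (\<Sum>v\<in>V. real (card {e \<in> A. v \<in> e} choose d))"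
    proof -
      have "{i \<in> I2. snd i \<subseteq> A} = (SIGMA v:V. {F. F \<subseteq> {e \<in> A. v \<in> e} \<and> card F = d})"
      proof -
        have "F \<subseteq> {e \<in> complete_edges V. v \<in> e} \<and> F \<subseteq> A \<longleftrightarrow> F \<subseteq> {e \<in> A. v \<in> e}" for F v
          using AX by blast
        then show ?thesis unfolding I2_def S2_def by fastforce
      qed
      then show ?thesis using finV fA by (simp add: card_SigmaI n_subsets)
    qed
    ultimately have "(\<Sum>v\<in>V. real (card {e \<in> A. v \<in> e} choose d)) \<le> 24 * n / K"
      using K n by (simp add: s_def field_simps)
    then show "(\<forall>W. W \<subseteq> V \<longrightarrow> W \<noteq> {} \<longrightarrow> card W \<le> \<alpha> * n \<longrightarrow>
          card {e \<in> avoider_claims ms. e \<subseteq> W} < k * card W) \<and>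
        (\<Sum>v\<in>V. real (card {e \<in> avoider_claims ms. v \<in> e} choose d)) \<le> 24 * n / K"
      using sparse by (simp add: A_def)
  qed
qed

text \<open>All edges at vertices of degree more than \<open>d\<close> are deleted. Each such vertex
  has at least as many stars with \<open>d\<close> edges as edges, so at most \<open>s\<close> edges
  are lost.\<close>

lemma ex_bounded_degree_subgraph:
  fixes d :: nat and s :: real
  assumes fin: "finite V" and A: "A \<subseteq> complete_edges V" and d: "1 \<le> d"
    and stars: "(\<Sum>v\<in>V. real (card {e \<in> A. v \<in> e} choose d)) \<le> s"
  shows "\<exists>E \<subseteq> A. card A - s \<le> card E \<and> (\<forall>v. card {e \<in> E. v \<in> e} \<le> d)"
proof -
  define H where "H = {v \<in> V. d < card {e \<in> A. v \<in> e}}"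
  define E where "E = {e \<in> A. e \<inter> H = {}}"
  have finA: "finite A" using A finite_complete_edges[OF fin] finite_subset by blast
  have finH: "finite H" using fin by (simp add: H_def)
  have "A = E \<union> (\<Union>v\<in>H. {e \<in> A. v \<in> e})" by (auto simp: E_def)
  then have "card A \<le> card E + card (\<Union>v\<in>H. {e \<in> A. v \<in> e})" by (metis card_Un_le)
  also have "card (\<Union>v\<in>H. {e \<in> A. v \<in> e}) \<le> (\<Sum>v\<in>H. card {e \<in> A. v \<in> e})"
    by (rule card_UN_le[OF finH])
  also have "\<dots> \<le> (\<Sum>v\<in>H. card {e \<in> A. v \<in> e} choose d)"
    using d by (intro sum_mono le_choose) (auto simp: H_def)
  also have "\<dots> \<le> (\<Sum>v\<in>V. card {e \<in> A. v \<in> e} choose d)"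
    using fin by (intro sum_mono2) (auto simp: H_def)
  finally have "card A \<le> card E + (\<Sum>v\<in>V. card {e \<in> A. v \<in> e} choose d)" by simp
  then have "real (card A) \<le> real (card E + (\<Sum>v\<in>V. card {e \<in> A. v \<in> e} choose d))"
    by (simp only: of_nat_le_iff)
  then have "real (card A) \<le> card E + (\<Sum>v\<in>V. real (card {e \<in> A. v \<in> e} choose d))" by simp
  moreover have "card {e \<in> E. v \<in> e} \<le> d" for v
  proof (cases "v \<in> V \<and> v \<notin> H")
    case True
    have "card {e \<in> E. v \<in> e} \<le> card {e \<in> A. v \<in> e}" using finA by (intro card_mono) (auto simp: E_def)
    then show ?thesis using True unfolding H_def by auto
  next
    case False
    have "e \<subseteq> V" if "e \<in> A" for e using A that by (auto simp: complete_edges_def)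
    then have "{e \<in> E. v \<in> e} = {}" using False by (auto simp: E_def)
    then show ?thesis by (metis card.empty le0)
  qed
  ultimately show ?thesis using stars by (intro exI[of _ E]) (auto simp: E_def)
qed

lemma sum_adj_le_card:
  assumes "finite U" "finite E"
  shows "(\<Sum>y\<in>U. adj E x y) \<le> card {e \<in> E. x \<in> e}"
proof -
  have "(\<Sum>y\<in>U. adj E x y) = card {y \<in> U. {x, y} \<in> E}"
    using assms by (simp add: adj_def Int_def)
  moreover have "card {y \<in> U. {x, y} \<in> E} \<le> card {e \<in> E. x \<in> e}"
    by (rule card_inj_on_le[of "\<lambda>y. {x, y}"]) (use assms in \<open>auto simp: inj_on_def doubleton_eq_iff\<close>)
  ultimately show ?thesis by simp
qed

text \<open>The part without a game. Edge density, sparseness and degree bound all scale with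
  \<open>c\<close>, so one \<open>\<gamma>\<close> serves every bias.\<close>

lemma sparse_graph_has_minor:
  fixes \<epsilon> \<alpha> :: real
  assumes \<epsilon>: "0 < \<epsilon>" "\<epsilon> < 1" and \<alpha>: "0 < \<alpha>"
  shows "\<exists>\<gamma> > 0. \<forall>(n :: nat) A (c :: real) (d :: nat) (t :: nat). 16 \<le> \<alpha> * n \<longrightarrow> A \<subseteq> complete_edges {..<n} \<longrightarrow> 1 \<le> c \<longrightarrow> c * n \<le> card A \<longrightarrow>
     (\<forall>W. W \<subseteq> {..<n} \<longrightarrow> W \<noteq> {} \<longrightarrow> card W \<le> \<alpha> * n \<longrightarrow> card {e \<in> A. e \<subseteq> W} < c * (1 - \<epsilon> / 4) * card W) \<longrightarrow>
     (\<Sum>v<n. real (card {e \<in> A. v \<in> e} choose d)) \<le> \<epsilon> / 8 * n \<longrightarrow> 1 \<le> d \<longrightarrow> d \<le> 384 / \<epsilon> * c \<longrightarrow>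
     t \<le> \<gamma> * sqrt n \<longrightarrow>
     has_minor ({..<n}, A) (complete_graph {..<t})"
proof -
  \<comment> \<open>This is \<open>2 * \<delta> * \<alpha> / d\<close> for
    \<open>\<delta> = c * \<epsilon> / 8\<close> and the largest allowed degree bound
    \<open>d = 384 / \<epsilon> * c\<close>; the \<open>c\<close> cancels.\<close>
  define \<theta> where "\<theta> = \<epsilon>\<^sup>2 * \<alpha> / 1536"
  have \<theta>: "0 < \<theta>" using \<epsilon> \<alpha> by (simp add: \<theta>_def)
  obtain c0 where c0: "0 < c0" and minor: "\<forall>(U :: nat set) E D t. 16 \<le> card U \<longrightarrow> 0 < D \<longrightarrow>
     (\<forall>x\<in>U. (\<Sum>y\<in>U. adj E x y) \<le> D) \<longrightarrow>
     (\<forall>W\<subseteq>U. \<theta> * D * card W * card (U - W) / card U \<le> cut_size E W (U - W)) \<longrightarrow>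
     t \<le> c0 * sqrt (card U) \<longrightarrow>
     has_minor (U, E) (complete_graph {..<t :: nat})"
    using ex_sqrt_minor[OF \<theta>] by blast
  define \<gamma> where "\<gamma> = c0 * sqrt \<alpha>"
  have \<gamma>: "0 < \<gamma>" using c0 \<alpha> by (simp add: \<gamma>_def)
  have "has_minor ({..<n}, A) (complete_graph {..<t})"
    if n: "16 \<le> \<alpha> * n" and A: "A \<subseteq> complete_edges {..<n}" and c: "1 \<le> c" and cA: "c * n \<le> card A"
      and sparse: "\<forall>W. W \<subseteq> {..<n} \<longrightarrow> W \<noteq> {} \<longrightarrow> card W \<le> \<alpha> * n \<longrightarrow>
        card {e \<in> A. e \<subseteq> W} < c * (1 - \<epsilon> / 4) * card W"
      and stars: "(\<Sum>v<n. real (card {e \<in> A. v \<in> e} choose d)) \<le> \<epsilon> / 8 * n"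
      and d: "1 \<le> d" "d \<le> 384 / \<epsilon> * c" and t: "t \<le> \<gamma> * sqrt n" for n :: nat and A and c :: real and d t :: nat
  proof -
    \<comment> \<open>Half of the gap \<open>c * \<epsilon> / 4\<close> between the average and the
      sparseness bound. The other half pays for the at most \<open>\<epsilon> / 8 * n\<close>
      deleted edges.\<close>
    define \<delta> where "\<delta> = c * \<epsilon> / 8"
    have \<delta>: "0 < \<delta>" using c \<epsilon> by (simp add: \<delta>_def)
    have n0: "0 < n"
    proof (rule ccontr)
      assume "\<not> 0 < n"
      then show False using n by simp
    qed
    obtain E where E: "E \<subseteq> A" "card A - \<epsilon> / 8 * n \<le> card E" "\<forall>v. card {e \<in> E. v \<in> e} \<le> d"
      using ex_bounded_degree_subgraph[OF _ A d(1) stars] by auto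
    have finA: "finite A" using A finite_complete_edges[of "{..<n}"] finite_subset by blast
    have finE: "finite E" using E(1) finA finite_subset by blast
    have "\<exists>U \<subseteq> {..<n}. \<alpha> * card {..<n} < card U \<and>
       (\<forall>W \<subseteq> U. 2 * \<delta> * card W * card (U - W) / card {..<n} \<le> cut_size E W (U - W))"
    proof (rule ex_expanding_subset[where c = "c * (1 - \<epsilon> / 4)"])
      show "E \<subseteq> complete_edges {..<n}" using E A by blast
      have "\<epsilon> / 8 * n \<le> c * (\<epsilon> / 8 * n)" using c \<epsilon> mult_right_mono[of 1 c "\<epsilon> / 8 * n"] by simp
      then show "(c * (1 - \<epsilon> / 4) + \<delta>) * card {..<n} \<le> card E"
        using E(2) cA by (simp add: \<delta>_def algebra_simps)
      show "card {e \<in> E. e \<subseteq> W} < c * (1 - \<epsilon> / 4) * card W"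
        if "W \<subseteq> {..<n}" "W \<noteq> {}" "card W \<le> \<alpha> * card {..<n}" for W
      proof -
        have "card {e \<in> E. e \<subseteq> W} \<le> card {e \<in> A. e \<subseteq> W}"
          using E(1) finA by (intro card_mono) auto
        then have "real (card {e \<in> E. e \<subseteq> W}) \<le> card {e \<in> A. e \<subseteq> W}" by simp
        also have "\<dots> < c * (1 - \<epsilon> / 4) * card W" using sparse that by simp
        finally show ?thesis .
      qed
    qed (use n0 \<delta> in auto)
    then obtain U where U: "U \<subseteq> {..<n}" "\<alpha> * n < card U"
      and cut: "\<And>W. W \<subseteq> U \<Longrightarrow> 2 * \<delta> * card W * card (U - W) / n \<le> cut_size E W (U - W)"
      by auto
    have finU: "finite U" using U finite_subset by blast
    have u0: "0 < card U"
    proof (rule ccontr)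
      assume "\<not> 0 < card U"
      then show False using U(2) n by simp
    qed
    have "has_minor (U, E) (complete_graph {..<t})"
    proof (rule minor[rule_format, where D = "real d"])
      show "16 \<le> card U" using U(2) n by linarith
      show "0 < real d" using d by simp
      show "(\<Sum>y\<in>U. adj E x y) \<le> real d" if "x \<in> U" for x
        using sum_adj_le_card[OF finU finE, of x] E(3) by (meson of_nat_mono order_trans)
      fix W assume W: "W \<subseteq> U"
      have "\<theta> * d * n \<le> 2 * \<delta> * card U"
      proof -
        have "\<theta> * d \<le> \<theta> * (384 / \<epsilon> * c)" using d \<theta> by (intro mult_left_mono) auto
        also have "\<dots> = 2 * \<delta> * \<alpha>" using \<epsilon> by (simp add: \<theta>_def \<delta>_def power2_eq_square)
        finally have "\<theta> * d * n \<le> 2 * \<delta> * \<alpha> * n" by (intro mult_right_mono) auto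
        also have "\<dots> = 2 * \<delta> * (\<alpha> * n)" by simp
        also have "\<dots> \<le> 2 * \<delta> * card U" using U(2) \<delta> by (intro mult_left_mono) auto
        finally show ?thesis .
      qed
      then have "\<theta> * d / card U \<le> 2 * \<delta> / n" using u0 n0 by (simp add: field_simps)
      then have "\<theta> * d / card U * (card W * card (U - W)) \<le> 2 * \<delta> / n * (card W * card (U - W))"
        by (intro mult_right_mono) auto
      then show "\<theta> * d * card W * card (U - W) / card U \<le> cut_size E W (U - W)"
        using cut[OF W] by (simp add: mult.assoc)
    next
      have "\<gamma> * sqrt n = c0 * sqrt (\<alpha> * n)" by (simp add: \<gamma>_def real_sqrt_mult)
      also have "\<dots> \<le> c0 * sqrt (card U)" using U(2) c0 by (intro mult_left_mono) auto
      finally show "t \<le> c0 * sqrt (card U)" using t by linarith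
    qed
    then show ?thesis using U(1) E(1) by (rule has_minor_mono)
  qed
  then show ?thesis using \<gamma> by blast
qed

text \<open>\<open>c\<close> is the number of edges per vertex that Avoider is bound to claim: the
  edges of the board divided by the \<open>1 + b\<close> edges of a round, less one for the
  additional move that Enforcer may have. It is about \<open>n / (2 * (1 + b))\<close>, and the
  factor 4 in the second bound leaves room for lower order terms.\<close>

lemma avoider_average_degree:
  fixes n b :: nat and \<epsilon> c :: real
  defines "c \<equiv> (real n * (real n - 1) / 2 / (1 + real b) - 1) / n"
  assumes \<epsilon>: "0 < \<epsilon>" "\<epsilon> < 1" and n: "12 \<le> \<epsilon> * n" and b: "b \<le> (1 - \<epsilon>) * (n / 2)"
  shows "1 + \<epsilon> / 2 \<le> c" "n \<le> 4 * c * (1 + real b)"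
proof -
  define B where "B = 1 + real b"
  have B: "0 < B" "B \<le> (1 - \<epsilon>) * (n / 2) + 1" using b by (auto simp: B_def)
  have "\<epsilon> * n \<le> 1 * real n" using \<epsilon> by (intro mult_right_mono) auto
  then have n12: "12 \<le> real n" using n by linarith
  \<comment> \<open>The margin is \<open>(1 - \<epsilon>) * (1 + \<epsilon> / 2) \<le> 1 -
    \<epsilon> / 2\<close>. It leaves \<open>\<epsilon> * n * n / 4\<close>, which exceeds the
    linear terms as soon as \<open>12 \<le> \<epsilon> * n\<close>.\<close>
  have "B * ((1 + \<epsilon> / 2) * n + 1) \<le> ((1 - \<epsilon>) * (n / 2) + 1) * ((1 + \<epsilon> / 2) * n + 1)"
    using B(2) \<epsilon> by (intro mult_right_mono) auto
  also have "\<dots> = (1 - \<epsilon> / 2 - \<epsilon>\<^sup>2 / 2) * (real n * n / 2) + (3 / 2) * n + 1"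
    by (simp add: field_simps power2_eq_square)
  also have "\<dots> \<le> (1 - \<epsilon> / 2) * (real n * n / 2) + (3 / 2) * n + 1"
    by (intro add_right_mono mult_right_mono) auto
  also have "\<dots> \<le> real n * (real n - 1) / 2"
  proof -
    have "(1 - \<epsilon> / 2) * (x * x / 2) + (3 / 2) * x + 1 \<le> x * (x - 1) / 2"
      if "12 \<le> \<epsilon> * x" "12 \<le> x" for x :: real
    proof -
      have "x * (x - 1) / 2 - ((1 - \<epsilon> / 2) * (x * x / 2) + (3 / 2) * x + 1) = \<epsilon> * x * x / 4 - 2 * x - 1"
        by (simp add: field_simps)
      moreover have "12 * x \<le> \<epsilon> * x * x" using that by (intro mult_right_mono) auto
      ultimately show ?thesis using that(2) by linarith
    qed
    then show ?thesis using n n12 by blast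
  qed
  finally have "(1 + \<epsilon> / 2) * n + 1 \<le> real n * (real n - 1) / 2 / B"
    using B(1) by (simp add: field_simps)
  then have "(1 + \<epsilon> / 2) * n \<le> c * n" using n12 by (simp add: c_def B_def)
  then show c1: "1 + \<epsilon> / 2 \<le> c" using n12 by simp
  have cB: "c * n + 1 = real n * (real n - 1) / 2 / B" using n12 by (simp add: c_def B_def)
  have "c * 12 \<le> c * n" using c1 \<epsilon> n12 by (intro mult_left_mono) auto
  moreover have "2 * c * (real n - 1) = 2 * (c * n) - 2 * c" by (simp add: algebra_simps)
  ultimately have "c * n + 1 \<le> 2 * c * (real n - 1)" using c1 \<epsilon> by linarith
  then have "real n * (real n - 1) / 2 / B \<le> 2 * c * (real n - 1)" using cB by simp
  then have "real n * (real n - 1) \<le> 4 * c * B * (real n - 1)" using B by (simp add: field_simps)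
  then show "n \<le> 4 * c * (1 + real b)" using n12 by (simp add: B_def)
qed

theorem theorem4:
  "\<exists>\<epsilon>\<^sub>0 > 0. \<forall>\<epsilon> :: real. 0 < \<epsilon> \<and> \<epsilon> < \<epsilon>\<^sub>0 \<longrightarrow>
     (\<exists>c :: real. c > 0 \<and> (\<exists>N :: nat. \<forall>n \<ge> N. \<forall>b :: nat.
        1 \<le> b \<and> real b \<le> (1 - \<epsilon>) * (real n / 2) \<longrightarrow>
        enforcer_can_force (complete_edges {..<n}) b
          (\<lambda>A. has_minor ({..<n}, A) (complete_graph {..<nat \<lfloor>c * sqrt (real n)\<rfloor>}))))"
proof (rule exI[of _ 1], intro conjI allI impI)
  fix \<epsilon> :: real assume "0 < \<epsilon> \<and> \<epsilon> < 1"
  then have \<epsilon>: "0 < \<epsilon>" "\<epsilon> < 1" by auto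
  \<comment> \<open>Since \<open>\<epsilon> < 1\<close>, the product
    \<open>(1 + \<epsilon> / 2) * (1 - \<epsilon> / 4)\<close> is at least
    \<open>1 + \<epsilon> / 8\<close>, so \<open>k = c * (1 - \<epsilon> / 4)\<close> is at least
    \<open>1 + \<xi>\<close>.\<close>
  define \<xi> where "\<xi> = \<epsilon> / 8"
  define \<alpha> where "\<alpha> = ((1/144 :: real) powr (1/\<xi>)) / 12"
  \<comment> \<open>Makes the bound \<open>24 * n / K\<close> on the number of stars equal to the
    affordable \<open>\<epsilon> / 8 * n\<close>.\<close>
  define K where "K = 192 / \<epsilon>"
  have \<xi>: "0 < \<xi>" using \<epsilon> by (simp add: \<xi>_def)
  have \<alpha>: "0 < \<alpha>" by (simp add: \<alpha>_def)
  have K: "192 \<le> K" using \<epsilon> by (simp add: K_def field_simps)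
  obtain \<gamma> where \<gamma>: "0 < \<gamma>" and minor: "\<forall>(n :: nat) A (c :: real) (d :: nat) (t :: nat). 16 \<le> \<alpha> * n \<longrightarrow> A \<subseteq> complete_edges {..<n} \<longrightarrow>
     1 \<le> c \<longrightarrow> c * n \<le> card A \<longrightarrow>
     (\<forall>W. W \<subseteq> {..<n} \<longrightarrow> W \<noteq> {} \<longrightarrow> card W \<le> \<alpha> * n \<longrightarrow> card {e \<in> A. e \<subseteq> W} < c * (1 - \<epsilon> / 4) * card W) \<longrightarrow>
     (\<Sum>v<n. real (card {e \<in> A. v \<in> e} choose d)) \<le> \<epsilon> / 8 * n \<longrightarrow> 1 \<le> d \<longrightarrow> d \<le> 384 / \<epsilon> * c \<longrightarrow>
     t \<le> \<gamma> * sqrt n \<longrightarrow>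
     has_minor ({..<n}, A) (complete_graph {..<t})"
    using sparse_graph_has_minor[OF \<epsilon> \<alpha>] by blast
  define N where "N = nat \<lceil>max (16 / \<alpha>) (12 / \<epsilon>)\<rceil>"
  show "\<exists>c :: real. c > 0 \<and> (\<exists>N :: nat. \<forall>n \<ge> N. \<forall>b :: nat.
        1 \<le> b \<and> real b \<le> (1 - \<epsilon>) * (real n / 2) \<longrightarrow>
        enforcer_can_force (complete_edges {..<n}) b
          (\<lambda>A. has_minor ({..<n}, A) (complete_graph {..<nat \<lfloor>c * sqrt (real n)\<rfloor>})))"
  proof (intro exI[of _ \<gamma>] conjI \<gamma> exI[of _ N] allI impI)
    fix n b :: nat assume nN: "N \<le> n" and "1 \<le> b \<and> real b \<le> (1 - \<epsilon>) * (real n / 2)"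
    then have b: "1 \<le> b" "real b \<le> (1 - \<epsilon>) * (real n / 2)" by auto
    have "max (16 / \<alpha>) (12 / \<epsilon>) \<le> n" using nN unfolding N_def by linarith
    then have "16 / \<alpha> \<le> n" "12 / \<epsilon> \<le> n" by auto
    then have n: "16 \<le> \<alpha> * n" "12 \<le> \<epsilon> * n" using \<alpha> \<epsilon> by (auto simp: field_simps)
    define c where "c = (real n * (real n - 1) / 2 / (1 + real b) - 1) / n"
    have c: "1 + \<epsilon> / 2 \<le> c" "n \<le> 4 * c * (1 + real b)"
      unfolding c_def using avoider_average_degree[OF \<epsilon> n(2) b(2)] by auto
    define d where "d = nat \<lceil>K * c\<rceil>"
    have n0: "0 < n"
    proof (rule ccontr)
      assume "\<not> 0 < n"
      then show False using n by simp
    qed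
    have Kc: "1 \<le> K * c" using mult_mono[of 1 K 1 c] K c \<epsilon> by simp
    have d: "K * c \<le> d" "d \<le> K * c + 1" unfolding d_def using Kc by linarith+
    show "enforcer_can_force (complete_edges {..<n}) b
       (\<lambda>A. has_minor ({..<n}, A) (complete_graph {..<nat \<lfloor>\<gamma> * sqrt (real n)\<rfloor>}))"
    proof (rule enforcer_can_force_mono[OF enforcer_forces_sparse[where \<xi> = \<xi> and c = c and K = K
            and d = d and k = "c * (1 - \<epsilon> / 4)"]], goal_cases)
      \<comment> \<open>Goal 9 is the passage from a sparse graph to the minor; the eight before it
        are the conditions on the parameters.\<close>
      case (9 ms)
      define A where "A = avoider_claims ms"
      have sparse: "\<forall>W. W \<subseteq> {..<n} \<longrightarrow> W \<noteq> {} \<longrightarrow> card W \<le> \<alpha> * n \<longrightarrow>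
          card {e \<in> A. e \<subseteq> W} < c * (1 - \<epsilon> / 4) * card W"
        and stars: "(\<Sum>v<n. real (card {e \<in> A. v \<in> e} choose d)) \<le> 24 * n / K"
        using 9(3) by (auto simp: A_def \<alpha>_def)
      show ?case unfolding A_def[symmetric]
      proof (rule minor[rule_format, where c = c and d = d])
        show "16 \<le> \<alpha> * n" by (rule n(1))
        show "A \<subseteq> complete_edges {..<n}"
          using legal_play_claims[OF finite_complete_edges 9(1)] by (simp add: A_def)
        show "1 \<le> c" using c \<epsilon> by linarith
        have "card (complete_edges {..<n}) \<le> (b + 1) * card A + b"
          using card_avoider_claims_ge[OF finite_complete_edges 9(1,2)] by (simp add: A_def)
        then have "real (n choose 2) \<le> real ((b + 1) * card A + b)"
          by (simp add: card_complete_edges del: of_nat_add of_nat_mult)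
        also have "real (n choose 2) = real n * (real n - 1) / 2"
          using n0 by (simp add: choose_two real_of_nat_div of_nat_diff)
        finally have "real n * (real n - 1) / 2 \<le> (1 + real b) * (card A + 1)" by (simp add: algebra_simps)
        then have "real n * (real n - 1) / 2 / (1 + real b) \<le> card A + 1" by (simp add: field_simps)
        then show "c * n \<le> card A" using n0 by (simp add: c_def)
        show "card {e \<in> A. e \<subseteq> W} < c * (1 - \<epsilon> / 4) * card W"
          if "W \<subseteq> {..<n}" "W \<noteq> {}" "card W \<le> \<alpha> * n" for W using sparse that by blast
        have "24 * n / K = \<epsilon> / 8 * n" using \<epsilon> by (simp add: K_def)
        then show "(\<Sum>v<n. real (card {e \<in> A. v \<in> e} choose d)) \<le> \<epsilon> / 8 * n" using stars by simp
        show "1 \<le> d" using d Kc by linarith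
        \<comment> \<open>Rounding up at most doubles \<open>K * c\<close>, whence the constant
          \<open>384 = 2 * 192\<close>.\<close>
        have "d \<le> 2 * (K * c)" using d Kc by linarith
        then show "d \<le> 384 / \<epsilon> * c" by (simp add: K_def)
        have "0 \<le> \<gamma> * sqrt n" using \<gamma> by simp
        then show "nat \<lfloor>\<gamma> * sqrt n\<rfloor> \<le> \<gamma> * sqrt n" by (rule of_nat_floor)
      qed
    next
      case 3
      have "(1 + \<epsilon> / 2) * (1 - \<epsilon> / 4) \<le> c * (1 - \<epsilon> / 4)" using c \<epsilon> by (intro mult_right_mono) auto
      moreover have "\<epsilon> * \<epsilon> \<le> 1 * \<epsilon>" using \<epsilon> by (intro mult_right_mono) auto
      ultimately show ?case by (simp add: \<xi>_def algebra_simps)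
    next
      case 4
      have "c * (\<epsilon> / 4) \<le> c * (1 / 2)" using c \<epsilon> by (intro mult_left_mono) auto
      then show ?case by (simp add: algebra_simps)
    qed (use b n0 \<xi> c K d \<epsilon> in auto)
  qed
qed simp

end
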